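(* Let $s>0$. There exists a constant $C_s>0$ such that for all $f,\varphi\in L^2(\mathbb{R}^2,\mathbb{H})$, $$\left(\iint_{\mathbb{R}^2\times\mathbb{R}^2}|\omega|^{2s}|\mathcal{G}^{\varphi}_{A_1,A_2}\{f\}(\omega,y)|^2\,d\omega\,dy\right)^{\frac12}\left(\iint_{\mathbb{R}^2\times\mathbb{R}^2}|y|^{2s}|\mathcal{G}^{\varphi}_{A_1,A_2}\{f\}(\omega,y)|^2\,d\omega\,dy\right)^{\frac12}\geq C_s\,\|f\|^2_{L^2(\mathbb{R}^2,\mathbb{H})}\,\|\varphi\|^2_{L^2(\mathbb{R}^2,\mathbb{H})}.$$
   Context: $\mathbb{H}$ is the algebra of real quaternions with units $i,j,k$, conjugation $\overline{q}$ and modulus $|q|=\sqrt{q\overline{q}}$. $L^2(\mathbb{R}^2,\mathbb{H})$ is the space of functions $f:\mathbb{R}^2\to\mathbb{H}$ with $\|f\|_{L^2(\mathbb{R}^2,\mathbb{H})}^2=\int_{\mathbb{R}^2}|f(x)|^2dx<\infty$. Fix real $2\times 2$ matrices $A_l=\begin{pmatrix}a_l&b_l\\c_l&d_l\end{pmatrix}$, $l=1,2$, with $a_ld_l-b_lc_l=1$ and $b_1b_2\neq 0$. Kernels: $K^{i}_{A_1}(x_1,\omega_1)=\frac{1}{\sqrt{2\pi b_1}}e^{\frac{i}{2}\left(\frac{a_1}{b_1}x_1^2-\frac{2}{b_1}x_1\omega_1+\frac{d_1}{b_1}\omega_1^2-\frac{\pi}{2}\right)}$ and $K^{j}_{A_2}(x_2,\omega_2)=\frac{1}{\sqrt{2\pi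 b_2}}e^{\frac{j}{2}\left(\frac{a_2}{b_2}x_2^2-\frac{2}{b_2}x_2\omega_2+\frac{d_2}{b_2}\omega_2^2-\frac{\pi}{2}\right)}$ (for negative $b_1$, resp. $b_2$, the square root is the principal one in $\mathbb{R}+\mathbb{R}i$, resp. $\mathbb{R}+\mathbb{R}j$). For a window $\varphi$, the Gabor quaternion linear canonical transform of $f$ is $$\mathcal{G}^{\varphi}_{A_1,A_2}\{f\}(\omega,y)=\int_{\mathbb{R}^2}K^{i}_{A_1}(x_1,\omega_1)f(x)\overline{\varphi(x-y)}K^{j}_{A_2}(x_2,\omega_2)\,dx,\qquad \omega,y\in\mathbb{R}^2.$$ $|\omega|$ and $|y|$ are Euclidean norms on $\mathbb{R}^2$. *)

theory Defs
  imports "HOL-Analysis.Analysis"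
begin

codatatype quat = Quat (qre: real) (qim1: real) (qim2: real) (qim3: real)

lemma quat_eqI:
  "qre p = qre q \<Longrightarrow> qim1 p = qim1 q \<Longrightarrow> qim2 p = qim2 q \<Longrightarrow> qim3 p = qim3 q \<Longrightarrow> p = q"
  by (rule quat.expand) simp

lemma quat_eq_iff:
  "p = q \<longleftrightarrow> qre p = qre q \<and> qim1 p = qim1 q \<and> qim2 p = qim2 q \<and> qim3 p = qim3 q"
  by (auto intro: quat_eqI)

instantiation quat :: ab_group_add
begin

primcorec zero_quat where
  "qre 0 = 0" | "qim1 0 = 0" | "qim2 0 = 0" | "qim3 0 = 0"

primcorec plus_quat where
  "qre (p + q) = qre p + qre q"
| "qim1 (p + q) = qim1 p + qim1 q"
| "qim2 (p + q) = qim2 p + qim2 q"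
| "qim3 (p + q) = qim3 p + qim3 q"

primcorec uminus_quat where
  "qre (- q) = - qre q"
| "qim1 (- q) = - qim1 q"
| "qim2 (- q) = - qim2 q"
| "qim3 (- q) = - qim3 q"

primcorec minus_quat where
  "qre (p - q) = qre p - qre q"
| "qim1 (p - q) = qim1 p - qim1 q"
| "qim2 (p - q) = qim2 p - qim2 q"
| "qim3 (p - q) = qim3 p - qim3 q"

instance
  by standard (simp_all add: quat_eq_iff)

end

primcorec qcnj :: "quat \<Rightarrow> quat" where
  "qre (qcnj q) = qre q"
| "qim1 (qcnj q) = - qim1 q"
| "qim2 (qcnj q) = - qim2 q"
| "qim3 (qcnj q) = - qim3 q"

instantiation quat :: ring_1
begin

primcorec one_quat where
  "qre 1 = 1" | "qim1 1 = 0" | "qim2 1 = 0" | "qim3 1 = 0"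

primcorec times_quat where
  "qre (p * q) = qre p * qre q - qim1 p * qim1 q - qim2 p * qim2 q - qim3 p * qim3 q"
| "qim1 (p * q) = qre p * qim1 q + qim1 p * qre q + qim2 p * qim3 q - qim3 p * qim2 q"
| "qim2 (p * q) = qre p * qim2 q - qim1 p * qim3 q + qim2 p * qre q + qim3 p * qim1 q"
| "qim3 (p * q) = qre p * qim3 q + qim1 p * qim2 q - qim2 p * qim1 q + qim3 p * qre q"

instance
  by standard (simp_all add: quat_eq_iff algebra_simps)

end

instantiation quat :: real_algebra_1
begin

primcorec scaleR_quat where
  "qre (scaleR r q) = r * qre q"
| "qim1 (scaleR r q) = r * qim1 q"
| "qim2 (scaleR r q) = r * qim2 q"
| "qim3 (scaleR r q) = r * qim3 q"

instance
  by standard (simp_all add: quat_eq_iff algebra_simps)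

end

instantiation quat :: real_inner
begin

definition inner_quat_def:
  "inner p q = qre p * qre q + qim1 p * qim1 q + qim2 p * qim2 q + qim3 p * qim3 q"

definition norm_quat_def:
  "norm q = sqrt ((qre q)\<^sup>2 + (qim1 q)\<^sup>2 + (qim2 q)\<^sup>2 + (qim3 q)\<^sup>2)"

definition sgn_quat_def: "sgn (q::quat) = q /\<^sub>R norm q"

definition dist_quat_def: "dist (p::quat) q = norm (p - q)"

definition uniformity_quat_def [code del]:
  "(uniformity :: (quat \<times> quat) filter) = (INF e\<in>{0 <..}. principal {(x, y). dist x y < e})"

definition open_quat_def [code del]:
  "open (U :: quat set) \<longleftrightarrow> (\<forall>x\<in>U. eventually (\<lambda>(x', y). x' = x \<longrightarrow> y \<in> U) uniformity)"

instance
proof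
  fix x y z :: quat and r :: real and U :: "quat set"
  show "inner x y = inner y x"
    by (simp add: inner_quat_def mult.commute)
  show "inner (x + y) z = inner x z + inner y z"
    by (simp add: inner_quat_def distrib_right)
  show "inner (scaleR r x) y = r * inner x y"
    by (simp add: inner_quat_def distrib_left)
  show "0 \<le> inner x x"
    by (simp add: inner_quat_def)
  show "inner x x = 0 \<longleftrightarrow> x = 0"
    by (simp add: inner_quat_def add_nonneg_eq_0_iff quat_eq_iff)
  show "norm x = sqrt (inner x x)"
    by (simp add: inner_quat_def norm_quat_def power2_eq_square)
qed (rule sgn_quat_def dist_quat_def uniformity_quat_def open_quat_def)+

end

instantiation quat :: euclidean_space
begin

definition Basis_quat_def:
  "Basis = {Quat 1 0 0 0, Quat 0 1 0 0, Quat 0 0 1 0, Quat 0 0 0 1}"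

instance
  by standard (auto simp: Basis_quat_def inner_quat_def intro: quat_eqI)

end

lemma mult_qcnj: "q * qcnj q = of_real ((norm q)\<^sup>2)"
  by (simp add: of_real_def quat_eq_iff norm_quat_def power2_eq_square)

lemma qcnj_mult: "qcnj q * q = of_real ((norm q)\<^sup>2)"
  by (simp add: of_real_def quat_eq_iff norm_quat_def power2_eq_square)

instantiation quat :: real_normed_div_algebra
begin

definition inverse_quat_def: "inverse q = qcnj q /\<^sub>R (norm q)\<^sup>2" for q :: quat

definition divide_quat_def: "p div q = p * inverse q" for p q :: quat

instance
proof
  fix p q :: quat
  show "norm (p * q) = norm p * norm q"
    unfolding norm_quat_def real_sqrt_mult [symmetric]
    by (rule arg_cong [where f = sqrt]) (simp add: power2_eq_square algebra_simps)
  show "p div q = p * inverse q"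
    by (rule divide_quat_def)
  show "inverse (0::quat) = 0"
    by (simp add: inverse_quat_def quat_eq_iff)
  assume "q \<noteq> 0"
  then show "inverse q * q = 1" "q * inverse q = 1"
    by (simp_all add: inverse_quat_def qcnj_mult mult_qcnj of_real_def)
qed

end

definition qi :: quat where "qi = Quat 0 1 0 0"
definition qj :: quat where "qj = Quat 0 0 1 0"
definition qk :: quat where "qk = Quat 0 0 0 1"

lemma quat_units:
  "qi * qi = -1" "qj * qj = -1" "qk * qk = -1"
  "qi * qj = qk" "qj * qk = qi" "qk * qi = qj"
  "qj * qi = - qk" "qk * qj = - qi" "qi * qk = - qj"
  by (simp_all add: quat_eq_iff qi_def qj_def qk_def)

lemma norm_quat_conv: "norm q = sqrt (qre (q * qcnj q))"
  by (simp add: norm_quat_def power2_eq_square)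

definition L2H :: "(real^2 \<Rightarrow> quat) set" where
  "L2H = {f. f \<in> borel_measurable lebesgue \<and> integrable lebesgue (\<lambda>x. (norm (f x))\<^sup>2)}"

definition L2H_norm :: "(real^2 \<Rightarrow> quat) \<Rightarrow> real" where
  "L2H_norm f = sqrt (\<integral>x. (norm (f x))\<^sup>2 \<partial>lebesgue)"

text \<open>For an imaginary unit \<open>u\<close>, the complex number \<open>x + y\<i>\<close> read as the element
  \<open>x + y u\<close> of the plane \<open>\<real> + \<real>u\<close>.\<close>
definition quat_of_complex :: "quat \<Rightarrow> complex \<Rightarrow> quat" where
  "quat_of_complex u z = of_real (Re z) + Im z *\<^sub>R u"

text \<open>The kernel with values in \<open>\<real> + \<real>u\<close>, for \<open>u = i\<close> or \<open>u = j\<close>. The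
  square root is the principal one of that plane, also for a negative upper right entry of the
  matrix; \<open>exp\<close> is the exponential series of the algebra of quaternions.\<close>
definition lct_kernel :: "quat \<Rightarrow> real^2^2 \<Rightarrow> real \<Rightarrow> real \<Rightarrow> quat" where
  "lct_kernel u A x w =
    (let a = A$1$1; b = A$1$2; d = A$2$2 in
      1 / quat_of_complex u (csqrt (of_real (2 * pi * b))) *
      exp ((1/2 * (a / b * x\<^sup>2 - 2 / b * x * w + d / b * w\<^sup>2 - pi / 2)) *\<^sub>R u))"

definition GQLCT ::
  "real^2^2 \<Rightarrow> real^2^2 \<Rightarrow> (real^2 \<Rightarrow> quat) \<Rightarrow> (real^2 \<Rightarrow> quat) \<Rightarrow> real^2 \<Rightarrow> real^2 \<Rightarrow> quat" where
  "GQLCT A1 A2 \<phi> f \<omega> y =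
    (\<integral>x. lct_kernel qi A1 (x$1) (\<omega>$1) * f x * qcnj (\<phi> (x - y)) * lct_kernel qj A2 (x$2) (\<omega>$2)
      \<partial>lebesgue)"

definition ennsqrt :: "ennreal \<Rightarrow> ennreal" where
  "ennsqrt x = (if x = top then top else ennreal (sqrt (enn2real x)))"

end

theory Submission
  imports Defs "HOL-Probability.Probability"
begin

text \<open>Write \<open>G\<close> for the transform and \<open>E = \<parallel>f\<parallel>\<^sup>2 \<parallel>\<phi>\<parallel>\<^sup>2\<close>. By Cauchy--Schwarz, \<open>\<bar>G\<bar>\<^sup>2 \<le> K E\<close> everywhere with
  \<open>K = 1 / (4 \<pi>\<^sup>2 \<bar>b\<^sub>1 b\<^sub>2\<bar>)\<close>, while a Plancherel inequality for each \<open>y\<close> gives \<open>\<integral>\<integral> \<bar>G\<bar>\<^sup>2 \<ge> E\<close>. Hence a set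
  \<open>\<bar>\<omega>\<bar> \<le> R, \<bar>y\<bar> \<le> S\<close> with \<open>K \<pi>\<^sup>2 R\<^sup>2 S\<^sup>2 = 1/2\<close> carries at most half of the mass; the rest is controlled
  by the two moments divided by \<open>R powr (2 s)\<close> and \<open>S powr (2 s)\<close>, and it remains to balance
  \<open>R\<close> against \<open>S\<close>.

  For the Plancherel inequality the chirps are absorbed into the signal, which leaves a two-sided
  Fourier transform. Only the lower bound is needed, so it suffices to integrate against Gaussian weights
  below 1 and let them widen; this yields Gaussian means of the autocorrelation of the signal, which
  converge by the continuity of translations in \<open>L\<^sup>2\<close>.\<close>

section \<open>Unit exponentials and the kernels\<close>

text \<open>For each \<open>y\<close> the signal \<open>f x * qcnj (\<phi> (x - y))\<close> is a
  product of two square integrable functions. It is integrable for every \<open>y\<close>, so its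
  transform is a genuine integral with a pointwise bound; it is square integrable for almost every
  \<open>y\<close>, and the Plancherel inequality is applied to those slices. The obstacle is
  non-commutativity: the exponentials stand on both sides of the signal and lie in different planes,
  so the phases in the squared modulus of the transform cannot be merged as over the complex
  numbers. The square is therefore expanded with the real inner product, which is invariant under
  multiplication by a unit on either side; only phase differences remain. This expansion has no
  integrable majorant over frequency until a Gaussian weight supplies one, and then Fubini applies.
  At the end only the product of the two radii is prescribed. Their ratio is free to make both tails
  equal to the same multiple of the geometric mean of the moments, which turns a bound on a sum into
  a bound on a product.\<close>

lemma quat_unit_square:
  fixes u :: quat
  assumes "u * u = -1"
  shows quat_unit_re: "qre u = 0" and quat_unit_norm: "norm u = 1"
proof -
  have "norm u * norm u = norm (u * u)"
    by (simp add: norm_mult)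
  also have "\<dots> = 1"
    by (simp add: assms)
  finally show "norm u = 1"
    by (metis abs_norm_cancel abs_square_eq_1 power2_eq_square)
  show "qre u = 0"
  proof (rule ccontr)
    assume *: "qre u \<noteq> 0"
    \<comment> \<open>Each imaginary component of \<open>u * u\<close> is \<open>2 * qre u\<close>
      times that of \<open>u\<close>. A nonzero real part would thus force \<open>u\<close> to be
      real, with a nonnegative square.\<close>
    have eqs: "qre (u * u) = -1" "qim1 (u * u) = 0" "qim2 (u * u) = 0" "qim3 (u * u) = 0"
      by (simp_all add: assms)
    then have "qim1 u = 0" "qim2 u = 0" "qim3 u = 0"
      using * by simp_all
    then have "qre u * qre u = -1"
      using eqs(1) by simp
    then show False
      using zero_le_square[of "qre u"] by simp
  qed
qed

lemma norm_quat_of_complex: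
  assumes "u * u = -1"
  shows "norm (quat_of_complex u z) = cmod z"
proof -
  have n: "(qim1 u)\<^sup>2 + (qim2 u)\<^sup>2 + (qim3 u)\<^sup>2 = 1"
    using quat_unit_square[OF assms] by (simp add: norm_quat_def)
  have "(norm (quat_of_complex u z))\<^sup>2
      = (Re z)\<^sup>2 + (Im z)\<^sup>2 * ((qim1 u)\<^sup>2 + (qim2 u)\<^sup>2 + (qim3 u)\<^sup>2)"
    by (simp add: norm_quat_def quat_of_complex_def of_real_def power_mult_distrib distrib_left
        quat_unit_re[OF assms])
  also have "\<dots> = (cmod z)\<^sup>2"
    by (simp add: n cmod_power2)
  finally show ?thesis
    by simp
qed

lemma bounded_linear_quat_of_complex: "bounded_linear (quat_of_complex u)"
  unfolding quat_of_complex_def of_real_def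
  by (intro bounded_linear_add bounded_linear_compose[OF bounded_linear_scaleR_left]
      bounded_linear_Re bounded_linear_Im)

lemma quat_of_complex_of_real [simp]: "quat_of_complex u (complex_of_real r) = of_real r"
  by (simp add: quat_of_complex_def)

lemma quat_of_complex_mult:
  assumes "u * u = -1"
  shows "quat_of_complex u (z * w) = quat_of_complex u z * quat_of_complex u w"
proof -
  have "quat_of_complex u z * quat_of_complex u w
     = (Re z * Re w) *\<^sub>R 1 + (Re z * Im w + Im z * Re w) *\<^sub>R u + (Im z * Im w) *\<^sub>R (u * u)"
    by (simp add: quat_of_complex_def of_real_def algebra_simps)
  also have "\<dots> = quat_of_complex u (z * w)"
    by (simp add: assms quat_of_complex_def of_real_def algebra_simps)
  finally show ?thesis ..
qed

lemma quat_of_complex_inverse: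
  assumes "u * u = -1"
  shows "quat_of_complex u (inverse z) = inverse (quat_of_complex u z)"
proof (cases "z = 0")
  case True
  then show ?thesis by (simp add: quat_of_complex_def)
next
  case False
  then have "quat_of_complex u z * quat_of_complex u (inverse z) = 1"
    using quat_of_complex_of_real[of u 1] by (simp flip: quat_of_complex_mult[OF assms])
  then show ?thesis
    by (rule inverse_unique[symmetric])
qed

text \<open>\<open>quat_of_complex u\<close> is a continuous algebra embedding of the complex
  numbers, so it carries the exponential series of \<open>\<i> * of_real t\<close> term by term to
  that of \<open>t *\<^sub>R u\<close>.\<close>

lemma exp_scaleR_unit:
  assumes "u * u = -1"
  shows "exp (t *\<^sub>R u) = quat_of_complex u (cis t)"
proof -
  interpret bounded_linear "quat_of_complex u"
    by (rule bounded_linear_quat_of_complex)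
  have pow: "quat_of_complex u (z ^ n) = quat_of_complex u z ^ n" for z n
    using quat_of_complex_of_real[of u 1]
    by (induction n) (simp_all add: quat_of_complex_mult[OF assms])
  have "(\<lambda>n. quat_of_complex u ((\<i> * of_real t) ^ n /\<^sub>R fact n))
      sums quat_of_complex u (exp (\<i> * of_real t))"
    by (intro sums exp_converges)
  moreover have "quat_of_complex u (\<i> * of_real t) = t *\<^sub>R u"
    by (simp add: quat_of_complex_def)
  ultimately have "(\<lambda>n. (t *\<^sub>R u) ^ n /\<^sub>R fact n) sums quat_of_complex u (cis t)"
    by (simp add: scaleR pow cis_conv_exp)
  then show ?thesis
    using exp_converges sums_unique2 by blast
qed

abbreviation qcis :: "quat \<Rightarrow> real \<Rightarrow> quat" where
  "qcis u t \<equiv> quat_of_complex u (cis t)"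

lemma qcis_conv: "qcis u t = cos t *\<^sub>R 1 + sin t *\<^sub>R u"
  by (simp add: quat_of_complex_def of_real_def)

lemma qcis_add: "u * u = -1 \<Longrightarrow> qcis u (s + t) = qcis u s * qcis u t"
  by (simp add: quat_of_complex_mult flip: cis_mult)

lemma norm_qcis: "u * u = -1 \<Longrightarrow> norm (qcis u t) = 1"
  by (simp add: norm_quat_of_complex)

lemma continuous_on_qcis [continuous_intros]:
  fixes g :: "'a::t2_space \<Rightarrow> real"
  shows "continuous_on S g \<Longrightarrow> continuous_on S (\<lambda>x. qcis u (g x))"
  unfolding qcis_conv by (intro continuous_intros)

lemma borel_measurable_qcis [measurable (raw)]:
  assumes "g \<in> borel_measurable M"
  shows "(\<lambda>x. qcis u (g x)) \<in> borel_measurable M"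
  by (rule borel_measurable_continuous_on[OF _ assms]) (intro continuous_intros)

lemma bounded_linear_qcnj: "bounded_linear qcnj"
proof (rule bounded_linear_intro[where K = 1])
  show "norm (qcnj x) \<le> norm x * 1" for x
    by (simp add: norm_quat_def)
qed (simp_all add: quat_eq_iff)

lemma norm_qcnj [simp]: "norm (qcnj q) = norm q"
  by (simp add: norm_quat_def)

lemma borel_measurable_qcnj [measurable (raw)]:
  assumes "g \<in> borel_measurable M"
  shows "(\<lambda>x. qcnj (g x)) \<in> borel_measurable M"
  by (rule borel_measurable_continuous_on[OF _ assms])
    (simp add: bounded_linear.continuous_on[OF bounded_linear_qcnj])

definition lct_chirp :: "quat \<Rightarrow> real^2^2 \<Rightarrow> real \<Rightarrow> quat" where
  "lct_chirp u A x = qcis u (A$1$1 / (2 * A$1$2) * x\<^sup>2)"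

definition lct_factor :: "quat \<Rightarrow> real^2^2 \<Rightarrow> real \<Rightarrow> quat" where
  "lct_factor u A w = inverse (quat_of_complex u (csqrt (of_real (2 * pi * A$1$2))))
     * qcis u (A$2$2 / (2 * A$1$2) * w\<^sup>2 - pi / 4)"

text \<open>All factors lie in one commutative plane, so their order is free. The first order serves
  the kernel to the left of the signal, the second the kernel to its right: in both cases the chirp
  ends up next to the signal or is absorbed into it, and the factor depending on frequency alone
  stands outermost, where it can leave the integral.\<close>

lemma lct_kernel_factorization:
  assumes "u * u = -1"
  shows "lct_kernel u A x w = lct_factor u A w * qcis u (- (x * w / A$1$2)) * lct_chirp u A x"
    and "lct_kernel u A x w = lct_chirp u A x * qcis u (- (x * w / A$1$2)) * lct_factor u A w"
proof -
  have arg: "1/2 * (A$1$1 / A$1$2 * x\<^sup>2 - 2 / A$1$2 * x * w + A$2$2 / A$1$2 * w\<^sup>2 - pi / 2)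
    = (A$2$2 / (2 * A$1$2) * w\<^sup>2 - pi / 4) + (- (x * w / A$1$2)) + A$1$1 / (2 * A$1$2) * x\<^sup>2"
    by (simp add: field_simps)
  show 1: "lct_kernel u A x w = lct_factor u A w * qcis u (- (x * w / A$1$2)) * lct_chirp u A x"
    unfolding lct_kernel_def Let_def exp_scaleR_unit[OF assms] arg qcis_add[OF assms]
    by (simp add: lct_factor_def lct_chirp_def divide_quat_def mult.assoc)
  show "lct_kernel u A x w = lct_chirp u A x * qcis u (- (x * w / A$1$2)) * lct_factor u A w"
    unfolding 1 lct_factor_def lct_chirp_def
    by (simp flip: quat_of_complex_mult[OF assms] quat_of_complex_inverse[OF assms] add: ac_simps)
qed

lemma norm_lct_chirp: "u * u = -1 \<Longrightarrow> norm (lct_chirp u A x) = 1"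
  by (simp add: lct_chirp_def norm_qcis)

lemma norm_lct_factor:
  "u * u = -1 \<Longrightarrow> norm (lct_factor u A w) = 1 / sqrt (2 * pi * \<bar>A$1$2\<bar>)"
  by (simp add: lct_factor_def norm_mult norm_qcis norm_inverse norm_quat_of_complex abs_mult
      norm_csqrt) (simp add: inverse_eq_divide)

lemma measurable_lct_chirp [measurable (raw)]:
  assumes [measurable]: "g \<in> borel_measurable M"
  shows "(\<lambda>x. lct_chirp u A (g x)) \<in> borel_measurable M"
  unfolding lct_chirp_def by measurable

section \<open>Continuity of translations in \<open>L\<^sup>2\<close>\<close>

lemma nn_integral_lborel_translate:
  fixes f :: "'a::euclidean_space \<Rightarrow> ennreal"
  assumes "f \<in> borel_measurable borel"
  shows "(\<integral>\<^sup>+x. f (x - h) \<partial>lborel) = (\<integral>\<^sup>+x. f x \<partial>lborel)"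
proof -
  have "(\<integral>\<^sup>+x. f x \<partial>lborel) = (\<integral>\<^sup>+x. f x \<partial>distr lborel borel ((+) (- h)))"
    by (simp only: lborel_distr_plus)
  also have "\<dots> = (\<integral>\<^sup>+x. f (x - h) \<partial>lborel)"
    using assms by (subst nn_integral_distr) simp_all
  finally show ?thesis ..
qed

text \<open>Argument and value are truncated at the same level \<open>N\<close>, so that one
  \<open>B\<close> bounds both support and size. The error is dominated by \<open>H\<close> itself
  and vanishes at each point from some \<open>N\<close> on.\<close>

lemma L2_approx_bounded_support:
  fixes H :: "'a::euclidean_space \<Rightarrow> 'b::euclidean_space"
  assumes [measurable]: "H \<in> borel_measurable borel"
    and fin: "(\<integral>\<^sup>+x. ennreal ((norm (H x))\<^sup>2) \<partial>lborel) < \<infinity>" and "\<epsilon> > 0"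
  shows "\<exists>k B. k \<in> borel_measurable borel \<and> (\<forall>x. norm (k x) \<le> B) \<and> (\<forall>x. norm x > B \<longrightarrow> k x = 0) \<and>
    (\<integral>\<^sup>+x. ennreal ((norm (H x - k x))\<^sup>2) \<partial>lborel) < \<epsilon>"
proof -
  define k where "k N x = (if norm x \<le> real N \<and> norm (H x) \<le> real N then H x else 0)" for N x
  have [measurable]: "k N \<in> borel_measurable borel" for N
    unfolding k_def by measurable
  have "(\<lambda>N. \<integral>\<^sup>+x. ennreal ((norm (H x - k N x))\<^sup>2) \<partial>lborel) \<longlonglongrightarrow> (\<integral>\<^sup>+x. 0 \<partial>(lborel :: 'a measure))"
  proof (rule nn_integral_dominated_convergence[where w = "\<lambda>x. ennreal ((norm (H x))\<^sup>2)"])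
    show "AE x in lborel. ennreal ((norm (H x - k j x))\<^sup>2) \<le> ennreal ((norm (H x))\<^sup>2)" for j
      by (intro AE_I2) (simp add: k_def)
    show "AE x in lborel. (\<lambda>N. ennreal ((norm (H x - k N x))\<^sup>2)) \<longlonglongrightarrow> 0"
    proof (rule AE_I2)
      fix x
      obtain m :: nat where m: "max (norm x) (norm (H x)) \<le> real m"
        using real_arch_simple by blast
      then have "k N x = H x" if "N \<ge> m" for N
        using that by (auto simp: k_def)
      then have "eventually (\<lambda>N. ennreal ((norm (H x - k N x))\<^sup>2) = 0) sequentially"
        unfolding eventually_sequentially by (intro exI[of _ m]) simp
      then show "(\<lambda>N. ennreal ((norm (H x - k N x))\<^sup>2)) \<longlonglongrightarrow> 0"
        by (rule tendsto_eventually)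
    qed
  qed (use fin in auto)
  then have "eventually (\<lambda>N. (\<integral>\<^sup>+x. ennreal ((norm (H x - k N x))\<^sup>2) \<partial>lborel) < \<epsilon>) sequentially"
    using \<open>\<epsilon> > 0\<close> by (auto simp: order_tendsto_iff)
  then obtain N where "(\<integral>\<^sup>+x. ennreal ((norm (H x - k N x))\<^sup>2) \<partial>lborel) < \<epsilon>"
    by (auto simp: eventually_sequentially)
  then show ?thesis
    by (intro exI[of _ "k N"] exI[of _ "real N"]) (simp add: k_def)
qed

lemma norm_diff_square_le2:
  fixes a b c :: "'a::real_normed_vector"
  shows "(norm (a - c))\<^sup>2 \<le> 2 * (norm (a - b))\<^sup>2 + 2 * (norm (b - c))\<^sup>2"
proof -
  have "(norm (a - c))\<^sup>2 \<le> (norm (a - b) + norm (b - c))\<^sup>2"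
    using norm_triangle_ineq[of "a - b" "b - c"] by (intro power_mono) auto
  also have "\<dots> \<le> 2 * (norm (a - b))\<^sup>2 + 2 * (norm (b - c))\<^sup>2"
    using zero_le_power2[of "norm (a - b) - norm (b - c)"] by (simp add: power2_eq_square algebra_simps)
  finally show ?thesis .
qed

lemma nn_integral_norm_diff_square_triangle:
  fixes a b c :: "'a \<Rightarrow> 'b::euclidean_space"
  assumes [measurable]: "a \<in> borel_measurable M" "b \<in> borel_measurable M" "c \<in> borel_measurable M"
  shows "(\<integral>\<^sup>+x. ennreal ((norm (a x - c x))\<^sup>2) \<partial>M)
    \<le> 2 * (\<integral>\<^sup>+x. ennreal ((norm (a x - b x))\<^sup>2) \<partial>M) + 2 * (\<integral>\<^sup>+x. ennreal ((norm (b x - c x))\<^sup>2) \<partial>M)"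
proof -
  have "(\<integral>\<^sup>+x. ennreal ((norm (a x - c x))\<^sup>2) \<partial>M)
    \<le> (\<integral>\<^sup>+x. 2 * ennreal ((norm (a x - b x))\<^sup>2) + 2 * ennreal ((norm (b x - c x))\<^sup>2) \<partial>M)"
  proof (rule nn_integral_mono)
    fix x
    have "ennreal ((norm (a x - c x))\<^sup>2)
        \<le> ennreal (2 * (norm (a x - b x))\<^sup>2 + 2 * (norm (b x - c x))\<^sup>2)"
      by (intro ennreal_leI norm_diff_square_le2)
    then show "ennreal ((norm (a x - c x))\<^sup>2)
        \<le> 2 * ennreal ((norm (a x - b x))\<^sup>2) + 2 * ennreal ((norm (b x - c x))\<^sup>2)"
      by (simp add: ennreal_plus ennreal_mult)
  qed
  also have "\<dots> = 2 * (\<integral>\<^sup>+x. ennreal ((norm (a x - b x))\<^sup>2) \<partial>M)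
      + 2 * (\<integral>\<^sup>+x. ennreal ((norm (b x - c x))\<^sup>2) \<partial>M)"
    by (simp add: nn_integral_add nn_integral_cmult)
  finally show ?thesis .
qed

text \<open>A measurable function is a limit of continuous ones off a negligible set, but these need
  not be dominated. The radial retraction \<open>T\<close> and the cutoff \<open>c\<close> bound
  their values and supports while fixing the limit \<open>k0\<close>, and dominated convergence then
  gives convergence in the mean square.\<close>

lemma L2_approx_continuous:
  fixes H :: "'a::euclidean_space \<Rightarrow> 'b::euclidean_space"
  assumes H [measurable]: "H \<in> borel_measurable borel"
    and fin: "(\<integral>\<^sup>+x. ennreal ((norm (H x))\<^sup>2) \<partial>lborel) < \<infinity>" and "\<epsilon> > 0"
  shows "\<exists>k B. continuous_on UNIV k \<and> (\<forall>x. norm (k x) \<le> B) \<and> (\<forall>x. norm x > B \<longrightarrow> k x = 0) \<and>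
    (\<integral>\<^sup>+x. ennreal ((norm (H x - k x))\<^sup>2) \<partial>lborel) < \<epsilon>"
proof -
  have e4: "\<epsilon> / 4 > 0"
    using \<open>\<epsilon> > 0\<close> by (simp add: ennreal_zero_less_divide)
  obtain k0 B where k0 [measurable]: "k0 \<in> borel_measurable borel"
    and bd: "\<And>x. norm (k0 x) \<le> B" and supp: "\<And>x. norm x > B \<Longrightarrow> k0 x = 0"
    and near0: "(\<integral>\<^sup>+x. ennreal ((norm (H x - k0 x))\<^sup>2) \<partial>lborel) < \<epsilon> / 4"
    using L2_approx_bounded_support[OF H fin e4] by blast
  have "B \<ge> 0"
    using bd[of 0] norm_ge_zero order_trans by blast
  have "k0 measurable_on UNIV"
    by (intro lebesgue_measurable_imp_measurable_on measurable_completion) auto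
  then obtain N g where "negligible N" and cont: "\<And>n. continuous_on UNIV (g n)"
    and lim: "\<And>x. x \<notin> N \<Longrightarrow> (\<lambda>n. g n x) \<longlonglongrightarrow> k0 x"
    by (auto simp: measurable_on_def)
  have AEN: "AE x in lborel. x \<notin> N"
    using \<open>negligible N\<close> AE_not_in AE_completion_iff unfolding negligible_iff_null_sets by blast
  \<comment> \<open>The extra 1 keeps \<open>R\<close> positive even for \<open>B = 0\<close>, so
    that \<open>T\<close> divides by a positive number.\<close>
  define R where "R = B + 1"
  have "R > 0"
    using \<open>B \<ge> 0\<close> by (simp add: R_def)
  define T where "T v = (R / max R (norm v)) *\<^sub>R v" for v :: 'b
  define c where "c x = max 0 (min 1 (R + 1 - norm x))" for x :: 'a
  define k where "k n x = c x *\<^sub>R T (g n x)" for n x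
  have nT: "norm (T v) \<le> R" for v
    using \<open>R > 0\<close> by (simp add: T_def field_simps max_def)
  have contT: "continuous_on UNIV T"
    unfolding T_def using \<open>R > 0\<close> by (intro continuous_intros) (auto simp: max_def)
  have contk: "continuous_on UNIV (k n)" for n
    unfolding k_def c_def
    by (intro continuous_intros continuous_on_compose2[OF contT cont]) auto
  have [measurable]: "k n \<in> borel_measurable borel" for n
    using contk borel_measurable_continuous_onI by blast
  have c01: "0 \<le> c x" "c x \<le> 1" for x
    by (simp_all add: c_def)
  have nk: "norm (k n x) \<le> R" for n x
  proof -
    have "norm (k n x) \<le> 1 * R"
      unfolding k_def norm_scaleR using c01 nT by (intro mult_mono) auto
    then show ?thesis by simp
  qed
  have sk: "k n x = 0" if "norm x > R + 1" for n x
    using that by (simp add: k_def c_def)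
  have k0eq: "c x *\<^sub>R T (k0 x) = k0 x" for x
  proof (cases "norm x > B")
    case True
    then show ?thesis by (simp add: supp T_def)
  next
    case False
    then have "c x = 1"
      by (simp add: c_def R_def)
    moreover have "max R (norm (k0 x)) = R"
      using bd[of x] by (simp add: R_def)
    ultimately show ?thesis
      using \<open>R > 0\<close> by (simp add: T_def)
  qed
  have [measurable]: "cball 0 (R + 1) \<in> sets (borel :: 'a measure)"
    by simp
  have "(\<lambda>n. \<integral>\<^sup>+x. ennreal ((norm (k0 x - k n x))\<^sup>2) \<partial>lborel) \<longlonglongrightarrow> (\<integral>\<^sup>+x. 0 \<partial>(lborel :: 'a measure))"
  proof (rule nn_integral_dominated_convergence
      [where w = "\<lambda>x. ennreal ((2 * R)\<^sup>2) * indicator (cball 0 (R + 1)) x"])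
    show "AE x in lborel. ennreal ((norm (k0 x - k j x))\<^sup>2) \<le> ennreal ((2 * R)\<^sup>2) * indicator (cball 0 (R + 1)) x" for j
    proof (rule AE_I2)
      fix x
      have "norm (k0 x - k j x) \<le> 2 * R"
        using norm_triangle_ineq4[of "k0 x" "k j x"] bd[of x] nk[of j x] by (simp add: R_def)
      then have "(norm (k0 x - k j x))\<^sup>2 \<le> (2 * R)\<^sup>2"
        by (intro power_mono) auto
      moreover have "k0 x - k j x = 0" if "x \<notin> cball 0 (R + 1)"
        using that supp[of x] sk[of x j] by (simp add: R_def)
      ultimately show "ennreal ((norm (k0 x - k j x))\<^sup>2) \<le> ennreal ((2 * R)\<^sup>2) * indicator (cball 0 (R + 1)) x"
        by (cases "x \<in> cball 0 (R + 1)") (simp_all add: ennreal_leI)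
    qed
    show "(\<integral>\<^sup>+x. ennreal ((2 * R)\<^sup>2) * indicator (cball 0 (R + 1)) x \<partial>(lborel :: 'a measure)) < \<infinity>"
      using emeasure_bounded_finite[of "cball 0 (R + 1) :: 'a set"]
      by (subst nn_integral_cmult_indicator) (simp_all add: ennreal_mult_less_top)
    show "AE x in lborel. (\<lambda>n. ennreal ((norm (k0 x - k n x))\<^sup>2)) \<longlonglongrightarrow> 0"
      using AEN
    proof eventually_elim
      case (elim x)
      have "(\<lambda>n. c x *\<^sub>R T (g n x)) \<longlonglongrightarrow> c x *\<^sub>R T (k0 x)"
        by (intro tendsto_intros continuous_on_tendsto_compose[OF contT lim[OF elim]]) auto
      then have "(\<lambda>n. ennreal ((norm (k0 x - k n x))\<^sup>2)) \<longlonglongrightarrow> ennreal ((norm (k0 x - k0 x))\<^sup>2)"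
        unfolding k0eq k_def by (intro tendsto_intros tendsto_ennrealI)
      then show ?case by simp
    qed
  qed auto
  then have "eventually (\<lambda>n. (\<integral>\<^sup>+x. ennreal ((norm (k0 x - k n x))\<^sup>2) \<partial>lborel) < \<epsilon> / 4) sequentially"
    using e4 by (auto simp: order_tendsto_iff)
  then obtain n where n: "(\<integral>\<^sup>+x. ennreal ((norm (k0 x - k n x))\<^sup>2) \<partial>lborel) < \<epsilon> / 4"
    by (auto simp: eventually_sequentially)
  have "(\<integral>\<^sup>+x. ennreal ((norm (H x - k n x))\<^sup>2) \<partial>lborel)
      \<le> 2 * (\<integral>\<^sup>+x. ennreal ((norm (H x - k0 x))\<^sup>2) \<partial>lborel)
        + 2 * (\<integral>\<^sup>+x. ennreal ((norm (k0 x - k n x))\<^sup>2) \<partial>lborel)"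
    by (intro nn_integral_norm_diff_square_triangle) auto
  also have "\<dots> < 2 * (\<epsilon> / 4) + 2 * (\<epsilon> / 4)"
    using near0 n by (intro add_strict_mono ennreal_mult_strict_left_mono) auto
  also have "\<dots> = \<epsilon>"
  proof -
    have "2 * (\<epsilon> / 4) + 2 * (\<epsilon> / 4) = (2 + 2) * (\<epsilon> / 4)"
      by (simp only: distrib_right)
    also have "\<dots> = \<epsilon> * 4 / 4"
      by (simp add: ennreal_times_divide mult.commute)
    also have "\<dots> = \<epsilon>"
      by (rule mult_divide_eq_ennreal) auto
    finally show ?thesis .
  qed
  finally have "(\<integral>\<^sup>+x. ennreal ((norm (H x - k n x))\<^sup>2) \<partial>lborel) < \<epsilon>" .
  moreover have "norm (k n x) \<le> R + 1" for x
    using nk[of n x] by simp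
  ultimately show ?thesis
    using contk sk by (intro exI[of _ "k n"] exI[of _ "R + 1"]) auto
qed

lemma continuous_L2_translation:
  fixes k :: "'a::euclidean_space \<Rightarrow> 'b::euclidean_space"
  assumes cont: "continuous_on UNIV k"
    and bd: "\<And>x. norm (k x) \<le> B" and supp: "\<And>x. norm x > B \<Longrightarrow> k x = 0"
    and h: "h \<longlonglongrightarrow> 0"
  shows "(\<lambda>n. \<integral>\<^sup>+x. ennreal ((norm (k x - k (x - h n)))\<^sup>2) \<partial>lborel) \<longlonglongrightarrow> 0"
proof -
  have [measurable]: "k \<in> borel_measurable borel"
    using cont borel_measurable_continuous_onI by blast
  have "eventually (\<lambda>n. norm (h n) < 1) sequentially"
    using tendstoD[OF h, of 1] by simp
  then obtain m where m: "\<And>n. n \<ge> m \<Longrightarrow> norm (h n) < 1"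
    by (auto simp: eventually_sequentially)
  have [measurable]: "cball 0 (B + 1) \<in> sets (borel :: 'a measure)"
    by simp
  \<comment> \<open>From index \<open>m\<close> on the shifts are shorter than 1, so every
    difference vanishes outside the ball of radius \<open>B + 1\<close>, and one integrable majorant
    serves all of them.\<close>
  have "(\<lambda>n. \<integral>\<^sup>+x. ennreal ((norm (k x - k (x - h (n + m))))\<^sup>2) \<partial>lborel) \<longlonglongrightarrow> (\<integral>\<^sup>+x. 0 \<partial>(lborel :: 'a measure))"
  proof (rule nn_integral_dominated_convergence
      [where w = "\<lambda>x. ennreal ((2 * B)\<^sup>2) * indicator (cball 0 (B + 1)) x"])
    show "AE x in lborel. ennreal ((norm (k x - k (x - h (j + m))))\<^sup>2)
        \<le> ennreal ((2 * B)\<^sup>2) * indicator (cball 0 (B + 1)) x" for j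
    proof (rule AE_I2)
      fix x
      have "norm (k x - k (x - h (j + m))) \<le> 2 * B"
        using norm_triangle_ineq4[of "k x" "k (x - h (j + m))"] bd[of x] bd[of "x - h (j + m)"] by simp
      then have "(norm (k x - k (x - h (j + m))))\<^sup>2 \<le> (2 * B)\<^sup>2"
        by (intro power_mono) auto
      moreover have "k x - k (x - h (j + m)) = 0" if "x \<notin> cball 0 (B + 1)"
      proof -
        have "norm x > B + 1"
          using that by simp
        moreover have "norm x \<le> norm (x - h (j + m)) + norm (h (j + m))"
          using norm_triangle_ineq[of "x - h (j + m)" "h (j + m)"] by simp
        moreover have "norm (h (j + m)) < 1"
          by (intro m) simp
        ultimately show ?thesis
          by (simp add: supp)
      qed
      ultimately show "ennreal ((norm (k x - k (x - h (j + m))))\<^sup>2)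
          \<le> ennreal ((2 * B)\<^sup>2) * indicator (cball 0 (B + 1)) x"
        by (cases "x \<in> cball 0 (B + 1)") (simp_all add: ennreal_leI)
    qed
    show "(\<integral>\<^sup>+x. ennreal ((2 * B)\<^sup>2) * indicator (cball 0 (B + 1)) x \<partial>(lborel :: 'a measure)) < \<infinity>"
      using emeasure_bounded_finite[of "cball 0 (B + 1) :: 'a set"]
      by (subst nn_integral_cmult_indicator) (simp_all add: ennreal_mult_less_top)
    show "AE x in lborel. (\<lambda>n. ennreal ((norm (k x - k (x - h (n + m))))\<^sup>2)) \<longlonglongrightarrow> 0"
    proof (rule AE_I2)
      fix x
      have "(\<lambda>n. x - h (n + m)) \<longlonglongrightarrow> x - 0"
        by (intro tendsto_intros LIMSEQ_ignore_initial_segment h)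
      then have "(\<lambda>n. k (x - h (n + m))) \<longlonglongrightarrow> k x"
        by (intro continuous_on_tendsto_compose[OF cont]) auto
      then have "(\<lambda>n. ennreal ((norm (k x - k (x - h (n + m))))\<^sup>2)) \<longlonglongrightarrow> ennreal ((norm (k x - k x))\<^sup>2)"
        by (intro tendsto_intros tendsto_ennrealI)
      then show "(\<lambda>n. ennreal ((norm (k x - k (x - h (n + m))))\<^sup>2)) \<longlonglongrightarrow> 0"
        by simp
    qed
  qed auto
  then show ?thesis
    by - (rule LIMSEQ_offset[of _ m], simp)
qed

lemma L2_translation:
  fixes H :: "'a::euclidean_space \<Rightarrow> 'b::euclidean_space"
  assumes H [measurable]: "H \<in> borel_measurable borel"
    and fin: "(\<integral>\<^sup>+x. ennreal ((norm (H x))\<^sup>2) \<partial>lborel) < \<infinity>"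
    and h: "h \<longlonglongrightarrow> 0"
  shows "(\<lambda>n. \<integral>\<^sup>+x. ennreal ((norm (H x - H (x - h n)))\<^sup>2) \<partial>lborel) \<longlonglongrightarrow> 0"
  unfolding order_tendsto_iff
proof (intro conjI allI impI)
  fix \<epsilon> :: ennreal
  assume "0 < \<epsilon>"
  \<comment> \<open>The path from \<open>H\<close> through \<open>k\<close> and its translate to the
    translate of \<open>H\<close> uses the squared triangle inequality twice, with total weight
    \<open>2 + 2 * (2 + 2) = 10\<close>. The first and last errors agree by translation
    invariance.\<close>
  then have e10: "\<epsilon> / 10 > 0"
    by (simp add: ennreal_zero_less_divide)
  obtain k B where cont: "continuous_on UNIV k"
    and bd: "\<And>x. norm (k x) \<le> B" and supp: "\<And>x. norm x > B \<Longrightarrow> k x = 0"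
    and near: "(\<integral>\<^sup>+x. ennreal ((norm (H x - k x))\<^sup>2) \<partial>lborel) < \<epsilon> / 10"
    using L2_approx_continuous[OF H fin e10] by blast
  have [measurable]: "k \<in> borel_measurable borel"
    using cont borel_measurable_continuous_onI by blast
  have "eventually (\<lambda>n. (\<integral>\<^sup>+x. ennreal ((norm (k x - k (x - h n)))\<^sup>2) \<partial>lborel) < \<epsilon> / 10) sequentially"
    using continuous_L2_translation[OF cont bd supp h] e10 by (auto simp: order_tendsto_iff)
  then show "eventually (\<lambda>n. (\<integral>\<^sup>+x. ennreal ((norm (H x - H (x - h n)))\<^sup>2) \<partial>lborel) < \<epsilon>) sequentially"
  proof eventually_elim
    case (elim n)
    have near': "(\<integral>\<^sup>+x. ennreal ((norm (k (x - h n) - H (x - h n)))\<^sup>2) \<partial>lborel) < \<epsilon> / 10"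
      using near nn_integral_lborel_translate[of "\<lambda>x. ennreal ((norm (k x - H x))\<^sup>2)" "h n"]
      by (simp add: norm_minus_commute)
    have "(\<integral>\<^sup>+x. ennreal ((norm (H x - H (x - h n)))\<^sup>2) \<partial>lborel)
      \<le> 2 * (\<integral>\<^sup>+x. ennreal ((norm (H x - k x))\<^sup>2) \<partial>lborel)
        + 2 * (\<integral>\<^sup>+x. ennreal ((norm (k x - H (x - h n)))\<^sup>2) \<partial>lborel)"
      by (intro nn_integral_norm_diff_square_triangle) auto
    also have "\<dots> \<le> 2 * (\<integral>\<^sup>+x. ennreal ((norm (H x - k x))\<^sup>2) \<partial>lborel)
        + 2 * (2 * (\<integral>\<^sup>+x. ennreal ((norm (k x - k (x - h n)))\<^sup>2) \<partial>lborel)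
          + 2 * (\<integral>\<^sup>+x. ennreal ((norm (k (x - h n) - H (x - h n)))\<^sup>2) \<partial>lborel))"
      by (intro add_mono mult_left_mono nn_integral_norm_diff_square_triangle) auto
    also have "\<dots> < 2 * (\<epsilon> / 10) + 2 * (2 * (\<epsilon> / 10) + 2 * (\<epsilon> / 10))"
      using near near' elim by (intro add_strict_mono ennreal_mult_strict_left_mono) auto
    also have "\<dots> = (2 + 2 * (2 + 2)) * (\<epsilon> / 10)"
      by (simp only: distrib_right distrib_left mult.assoc)
    also have "\<dots> = \<epsilon> * 10 / 10"
      by (simp add: ennreal_times_divide mult.commute)
    also have "\<dots> = \<epsilon>"
      by (rule mult_divide_eq_ennreal) auto
    finally show ?case .
  qed
qed simp

lemma lborel_integral_translate:
  fixes f :: "'a::euclidean_space \<Rightarrow> 'b::{banach, second_countable_topology}"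
  assumes [measurable]: "f \<in> borel_measurable borel"
  shows "(\<integral>x. f (x - h) \<partial>lborel) = (\<integral>x. f x \<partial>lborel)"
    and "integrable lborel (\<lambda>x. f (x - h)) \<longleftrightarrow> integrable lborel f"
proof -
  have "(\<integral>x. f x \<partial>lborel) = (\<integral>x. f x \<partial>distr lborel borel ((+) (- h)))"
    by (simp only: lborel_distr_plus)
  also have "\<dots> = (\<integral>x. f (x - h) \<partial>lborel)"
    by (subst integral_distr) simp_all
  finally show "(\<integral>x. f (x - h) \<partial>lborel) = (\<integral>x. f x \<partial>lborel)" ..
  have "integrable lborel f \<longleftrightarrow> integrable (distr lborel borel ((+) (- h))) f"
    by (simp only: lborel_distr_plus)
  also have "\<dots> \<longleftrightarrow> integrable lborel (\<lambda>x. f (x - h))"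
    by (subst integrable_distr_eq) simp_all
  finally show "integrable lborel (\<lambda>x. f (x - h)) \<longleftrightarrow> integrable lborel f" ..
qed

lemma integrable_inner_L2:
  fixes f g :: "'a \<Rightarrow> 'b::euclidean_space"
  assumes [measurable]: "f \<in> borel_measurable M" "g \<in> borel_measurable M"
    and "integrable M (\<lambda>x. (norm (f x))\<^sup>2)" "integrable M (\<lambda>x. (norm (g x))\<^sup>2)"
  shows "integrable M (\<lambda>x. norm (f x) * norm (g x))" and "integrable M (\<lambda>x. f x \<bullet> g x)"
proof -
  have i: "integrable M (\<lambda>x. (norm (f x))\<^sup>2 + (norm (g x))\<^sup>2)"
    using assms by simp
  have b: "norm (f x) * norm (g x) \<le> (norm (f x))\<^sup>2 + (norm (g x))\<^sup>2" for x
    using sum_squares_bound[of "norm (f x)" "norm (g x)"] zero_le_power2[of "norm (f x)"]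
      zero_le_power2[of "norm (g x)"] mult_nonneg_nonneg[OF norm_ge_zero[of "f x"] norm_ge_zero[of "g x"]]
    by linarith
  show "integrable M (\<lambda>x. norm (f x) * norm (g x))"
    by (rule Bochner_Integration.integrable_bound[OF i]) (use b in auto)
  show "integrable M (\<lambda>x. f x \<bullet> g x)"
  proof (rule Bochner_Integration.integrable_bound[OF i])
    show "AE x in M. norm (f x \<bullet> g x) \<le> norm ((norm (f x))\<^sup>2 + (norm (g x))\<^sup>2)"
    proof (rule AE_I2)
      fix x
      show "norm (f x \<bullet> g x) \<le> norm ((norm (f x))\<^sup>2 + (norm (g x))\<^sup>2)"
        using Cauchy_Schwarz_ineq2[of "f x" "g x"] b[of x] by simp
    qed
  qed simp
qed

text \<open>Polarisation: since a translate has the same norm as \<open>H\<close>, the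
  autocorrelation at \<open>t\<close> is the squared norm minus half the squared distance between
  \<open>H\<close> and its translate. That distance tends to 0 by
  \<open>L2_translation\<close>.\<close>

lemma L2_autocorrelation_tendsto:
  fixes H :: "'a::euclidean_space \<Rightarrow> 'b::euclidean_space"
  assumes [measurable]: "H \<in> borel_measurable borel"
    and int: "integrable lborel (\<lambda>x. (norm (H x))\<^sup>2)"
    and h: "h \<longlonglongrightarrow> 0"
  shows "(\<lambda>n. \<integral>x. H x \<bullet> H (x - h n) \<partial>lborel) \<longlonglongrightarrow> (\<integral>x. (norm (H x))\<^sup>2 \<partial>lborel)"
proof -
  have intt: "integrable lborel (\<lambda>x. (norm (H (x - t)))\<^sup>2)" for t
    using int lborel_integral_translate(2)[of "\<lambda>x. (norm (H x))\<^sup>2" t] by simp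
  have dec: "(\<integral>x. H x \<bullet> H (x - t) \<partial>lborel)
      = (\<integral>x. (norm (H x))\<^sup>2 \<partial>lborel) - (\<integral>x. (norm (H x - H (x - t)))\<^sup>2 \<partial>lborel) / 2"
    and intd: "integrable lborel (\<lambda>x. (norm (H x - H (x - t)))\<^sup>2)" for t
  proof -
    have eq: "(norm (H x - H (x - t)))\<^sup>2 = (norm (H x))\<^sup>2 + (norm (H (x - t)))\<^sup>2 - 2 * (H x \<bullet> H (x - t))" for x
      by (simp add: power2_norm_eq_inner inner_diff inner_commute)
    have ii: "integrable lborel (\<lambda>x. H x \<bullet> H (x - t))"
      by (intro integrable_inner_L2 int intt) auto
    show "integrable lborel (\<lambda>x. (norm (H x - H (x - t)))\<^sup>2)"
      unfolding eq using int intt ii by simp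
    have "(\<integral>x. (norm (H x - H (x - t)))\<^sup>2 \<partial>lborel)
      = (\<integral>x. (norm (H x))\<^sup>2 \<partial>lborel) + (\<integral>x. (norm (H (x - t)))\<^sup>2 \<partial>lborel) - 2 * (\<integral>x. H x \<bullet> H (x - t) \<partial>lborel)"
      unfolding eq using int intt ii by simp
    then show "(\<integral>x. H x \<bullet> H (x - t) \<partial>lborel)
      = (\<integral>x. (norm (H x))\<^sup>2 \<partial>lborel) - (\<integral>x. (norm (H x - H (x - t)))\<^sup>2 \<partial>lborel) / 2"
      using lborel_integral_translate(1)[of "\<lambda>x. (norm (H x))\<^sup>2" t] by (simp add: field_simps)
  qed
  have fin: "(\<integral>\<^sup>+x. ennreal ((norm (H x))\<^sup>2) \<partial>lborel) < \<infinity>"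
    using int by (subst nn_integral_eq_integral) auto
  have "(\<lambda>n. ennreal (\<integral>x. (norm (H x - H (x - h n)))\<^sup>2 \<partial>lborel)) \<longlonglongrightarrow> ennreal 0"
    using L2_translation[OF _ fin h] by (simp add: nn_integral_eq_integral[OF intd])
  then have "(\<lambda>n. \<integral>x. (norm (H x - H (x - h n)))\<^sup>2 \<partial>lborel) \<longlonglongrightarrow> 0"
    by (rule tendsto_ennrealD) auto
  then have "(\<lambda>n. (\<integral>x. (norm (H x))\<^sup>2 \<partial>lborel) - (\<integral>x. (norm (H x - H (x - h n)))\<^sup>2 \<partial>lborel) / 2)
      \<longlonglongrightarrow> (\<integral>x. (norm (H x))\<^sup>2 \<partial>lborel) - 0 / 2"
    by (intro tendsto_intros) simp_all
  then show ?thesis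
    by (simp add: dec)
qed

section \<open>Gaussian weights\<close>

text \<open>By \<open>lborel_eq\<close> the measure on the plane is the image of a product measure
  indexed by \<open>Basis\<close>, here the two axis vectors. \<open>F\<close> assigns each of them
  its own factor, so that the rule for integrals of finite products applies.\<close>

lemma integral_lborel_vec2_prod:
  fixes f g :: "real \<Rightarrow> real"
  assumes f: "integrable lborel f" and g: "integrable lborel g"
  shows "has_bochner_integral lborel (\<lambda>x::real^2. f (x$1) * g (x$2))
    ((\<integral>x. f x \<partial>lborel) * (\<integral>x. g x \<partial>lborel))"
proof -
  let ?e1 = "axis 1 1 :: real^2" and ?e2 = "axis 2 1 :: real^2"
  let ?P = "\<Pi>\<^sub>M b\<in>(Basis :: (real^2) set). (lborel :: real measure)"
  let ?S = "\<lambda>x. \<Sum>b\<in>(Basis :: (real^2) set). x b *\<^sub>R b"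
  have [measurable]: "f \<in> borel_measurable borel" "g \<in> borel_measurable borel"
    using f g by auto
  have B: "Basis = {?e1, ?e2}"
    by (auto simp: Basis_vec_def UNIV_2)
  have ne: "?e1 \<noteq> ?e2"
    by (simp add: axis_eq_axis)
  define F where "F b = (if b = ?e1 then f else g)" for b
  have F: "integrable lborel (F b)" for b
    using f g by (simp add: F_def)
  interpret product_sigma_finite "\<lambda>_. lborel :: real measure" ..
  have eq: "f (?S x $ 1) * g (?S x $ 2) = (\<Prod>b\<in>Basis. F b (x b))" for x
    using ne by (simp add: B F_def axis_def)
  have [measurable]: "?S \<in> measurable ?P borel"
    by measurable
  have [measurable]: "(\<lambda>x::real^2. f (x$1) * g (x$2)) \<in> borel_measurable borel"
    by measurable
  have "(\<integral>x. f (?S x $ 1) * g (?S x $ 2) \<partial>?P) = (\<Prod>b\<in>Basis. \<integral>x. F b x \<partial>lborel)"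
    unfolding eq by (intro product_integral_prod F) simp
  then have "(\<integral>x. f (?S x $ 1) * g (?S x $ 2) \<partial>?P) = (\<integral>x. f x \<partial>lborel) * (\<integral>x. g x \<partial>lborel)"
    using ne by (simp add: B F_def)
  moreover have "integrable ?P (\<lambda>x. f (?S x $ 1) * g (?S x $ 2))"
    unfolding eq by (intro product_integrable_prod F) simp
  ultimately show ?thesis
    by (subst lborel_eq) (simp add: has_bochner_integral_iff integral_distr integrable_distr_eq)
qed

text \<open>This is the characteristic function of the standard normal distribution at
  \<open>c * \<sigma>\<close>, rescaled by the substitution \<open>w = \<sigma> * x\<close>.\<close>

lemma gaussian_cis_integral:
  fixes c \<sigma> :: real
  assumes "\<sigma> > 0"
  shows "has_bochner_integral lborel (\<lambda>w. exp (- w\<^sup>2 / (2 * \<sigma>\<^sup>2)) *\<^sub>R cis (c * w))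
    (complex_of_real (\<sigma> * sqrt (2 * pi) * exp (- (c * \<sigma>)\<^sup>2 / 2)))"
proof -
  have [measurable]: "(\<lambda>x. cis (c * \<sigma> * x)) \<in> borel_measurable borel"
    by (intro borel_measurable_continuous_onI continuous_intros)
  have int: "integrable lborel (\<lambda>x. std_normal_density x *\<^sub>R cis (c * \<sigma> * x))"
    by (rule Bochner_Integration.integrable_bound[OF integrable_normal_density[of 1 0]]) auto
  have val: "(\<integral>x. std_normal_density x *\<^sub>R cis (c * \<sigma> * x) \<partial>lborel) = complex_of_real (exp (- (c * \<sigma>)\<^sup>2 / 2))"
    using fun_cong[OF char_std_normal_distribution, of "c * \<sigma>"]
    unfolding char_def
    by (subst (asm) integral_density) (auto simp: cis_conv_exp mult.assoc)
  have "has_bochner_integral lborel (\<lambda>x. sqrt (2 * pi) *\<^sub>R (std_normal_density x *\<^sub>R cis (c * \<sigma> * x)))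
      (sqrt (2 * pi) *\<^sub>R complex_of_real (exp (- (c * \<sigma>)\<^sup>2 / 2)))"
    using int val by (intro has_bochner_integral_scaleR_right) (simp add: has_bochner_integral_iff)
  \<comment> \<open>The summand 0 here and the division by \<open>\<bar>\<sigma>\<bar>\<close> in
    the next equation bring both sides into the shape of the affine substitution rule used at the
    end.\<close>
  moreover have "sqrt (2 * pi) *\<^sub>R (std_normal_density x *\<^sub>R cis (c * \<sigma> * x))
      = exp (- (0 + \<sigma> * x)\<^sup>2 / (2 * \<sigma>\<^sup>2)) *\<^sub>R cis (c * (0 + \<sigma> * x))" for x
    using assms by (simp add: std_normal_density_def power_mult_distrib mult.assoc)
  moreover have "sqrt (2 * pi) *\<^sub>R complex_of_real (exp (- (c * \<sigma>)\<^sup>2 / 2))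
      = (\<sigma> *\<^sub>R sqrt (2 * pi) *\<^sub>R complex_of_real (exp (- (c * \<sigma>)\<^sup>2 / 2))) /\<^sub>R \<bar>\<sigma>\<bar>"
    using assms by (simp only: scaleR_scaleR) simp
  ultimately have "has_bochner_integral lborel
      (\<lambda>x. exp (- (0 + \<sigma> * x)\<^sup>2 / (2 * \<sigma>\<^sup>2)) *\<^sub>R cis (c * (0 + \<sigma> * x)))
      ((\<sigma> *\<^sub>R sqrt (2 * pi) *\<^sub>R complex_of_real (exp (- (c * \<sigma>)\<^sup>2 / 2))) /\<^sub>R \<bar>\<sigma>\<bar>)"
    by (simp only:)
  then show ?thesis
    using assms
    by (subst (asm) lborel_has_bochner_integral_real_affine_iff[symmetric])
      (auto simp: scaleR_conv_of_real mult.assoc)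
qed

lemma gaussian_cos_sin_integral:
  fixes c \<sigma> :: real
  assumes "\<sigma> > 0"
  shows "has_bochner_integral lborel (\<lambda>w. exp (- w\<^sup>2 / (2 * \<sigma>\<^sup>2)) * cos (c * w))
      (\<sigma> * sqrt (2 * pi) * exp (- (c * \<sigma>)\<^sup>2 / 2))"
    and "has_bochner_integral lborel (\<lambda>w. exp (- w\<^sup>2 / (2 * \<sigma>\<^sup>2)) * sin (c * w)) 0"
  using has_bochner_integral_bounded_linear[OF bounded_linear_Re gaussian_cis_integral[OF assms, of c]]
    has_bochner_integral_bounded_linear[OF bounded_linear_Im gaussian_cis_integral[OF assms, of c]]
  by simp_all

text \<open>Deliberately not normalised: with values at most 1 the weight can only lower the
  integral of a nonnegative function. The two widths are separate so that they can be matched to the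
  two kernel parameters.\<close>

definition gauss_weight :: "real \<Rightarrow> real \<Rightarrow> real^2 \<Rightarrow> real" where
  "gauss_weight \<sigma> \<tau> w = exp (- (w$1)\<^sup>2 / (2 * \<sigma>\<^sup>2)) * exp (- (w$2)\<^sup>2 / (2 * \<tau>\<^sup>2))"

lemma gauss_weight_bounds: "0 \<le> gauss_weight \<sigma> \<tau> w" "gauss_weight \<sigma> \<tau> w \<le> 1"
  unfolding gauss_weight_def by (auto intro!: mult_le_one)

lemma measurable_gauss_weight [measurable]: "gauss_weight \<sigma> \<tau> \<in> borel_measurable borel"
  unfolding gauss_weight_def by measurable

lemma gauss_weight_integral:
  assumes "\<sigma> > 0" "\<tau> > 0"
  shows "has_bochner_integral lborel (gauss_weight \<sigma> \<tau>) (2 * pi * \<sigma> * \<tau>)"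
proof -
  note G = gaussian_cos_sin_integral(1)[OF assms(1), of 0] gaussian_cos_sin_integral(1)[OF assms(2), of 0]
  have "has_bochner_integral lborel (gauss_weight \<sigma> \<tau>) ((\<sigma> * sqrt (2 * pi)) * (\<tau> * sqrt (2 * pi)))"
    using integral_lborel_vec2_prod[OF G[THEN integrable.intros]] G
    by (simp add: has_bochner_integral_iff gauss_weight_def[abs_def])
  then show ?thesis by (simp add: algebra_simps)
qed

text \<open>The sine terms of the two unit factors integrate to zero against the even weight, so that the
  non-commutativity of the quaternions plays no role.\<close>
lemma gauss_weight_two_sided:
  fixes q :: quat
  assumes "\<sigma> > 0" "\<tau> > 0"
  shows "has_bochner_integral lborel
      (\<lambda>w. gauss_weight \<sigma> \<tau> w *\<^sub>R (qcis u (c * w$1) * q * qcis v (d * w$2)))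
      ((2 * pi * \<sigma> * \<tau> * exp (- ((c * \<sigma>)\<^sup>2 + (d * \<tau>)\<^sup>2) / 2)) *\<^sub>R q)"
proof -
  let ?g = "\<lambda>t. \<lambda>w. exp (- w\<^sup>2 / (2 * t\<^sup>2)) :: real"
  note C = gaussian_cos_sin_integral(1)[OF assms(1), of c] and S = gaussian_cos_sin_integral(2)[OF assms(1), of c]
  note C' = gaussian_cos_sin_integral(1)[OF assms(2), of d] and S' = gaussian_cos_sin_integral(2)[OF assms(2), of d]
  note I = integrable.intros
  have cc: "has_bochner_integral lborel (\<lambda>w::real^2. (?g \<sigma> (w$1) * cos (c * w$1)) * (?g \<tau> (w$2) * cos (d * w$2)))
      ((\<sigma> * sqrt (2 * pi) * exp (- (c * \<sigma>)\<^sup>2 / 2)) * (\<tau> * sqrt (2 * pi) * exp (- (d * \<tau>)\<^sup>2 / 2)))"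
    using integral_lborel_vec2_prod[OF C[THEN I] C'[THEN I]] C C' by (simp only: has_bochner_integral_iff)
  have cs: "has_bochner_integral lborel (\<lambda>w::real^2. (?g \<sigma> (w$1) * cos (c * w$1)) * (?g \<tau> (w$2) * sin (d * w$2))) 0"
    using integral_lborel_vec2_prod[OF C[THEN I] S'[THEN I]] C S' by (simp only: has_bochner_integral_iff mult_zero_right)
  have sc: "has_bochner_integral lborel (\<lambda>w::real^2. (?g \<sigma> (w$1) * sin (c * w$1)) * (?g \<tau> (w$2) * cos (d * w$2))) 0"
    using integral_lborel_vec2_prod[OF S[THEN I] C'[THEN I]] S C' by (simp only: has_bochner_integral_iff mult_zero_left)
  have ss: "has_bochner_integral lborel (\<lambda>w::real^2. (?g \<sigma> (w$1) * sin (c * w$1)) * (?g \<tau> (w$2) * sin (d * w$2))) 0"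
    using integral_lborel_vec2_prod[OF S[THEN I] S'[THEN I]] S S' by (simp only: has_bochner_integral_iff mult_zero_left)
  have "has_bochner_integral lborel (\<lambda>w::real^2.
      ((?g \<sigma> (w$1) * cos (c * w$1)) * (?g \<tau> (w$2) * cos (d * w$2))) *\<^sub>R q
    + ((?g \<sigma> (w$1) * cos (c * w$1)) * (?g \<tau> (w$2) * sin (d * w$2))) *\<^sub>R (q * v)
    + ((?g \<sigma> (w$1) * sin (c * w$1)) * (?g \<tau> (w$2) * cos (d * w$2))) *\<^sub>R (u * q)
    + ((?g \<sigma> (w$1) * sin (c * w$1)) * (?g \<tau> (w$2) * sin (d * w$2))) *\<^sub>R (u * q * v))
    (((\<sigma> * sqrt (2 * pi) * exp (- (c * \<sigma>)\<^sup>2 / 2)) * (\<tau> * sqrt (2 * pi) * exp (- (d * \<tau>)\<^sup>2 / 2))) *\<^sub>R q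
      + 0 *\<^sub>R (q * v) + 0 *\<^sub>R (u * q) + 0 *\<^sub>R (u * q * v))"
    by (intro has_bochner_integral_add has_bochner_integral_scaleR_left cc cs sc ss)
  moreover have "((?g \<sigma> (w$1) * cos (c * w$1)) * (?g \<tau> (w$2) * cos (d * w$2))) *\<^sub>R q
    + ((?g \<sigma> (w$1) * cos (c * w$1)) * (?g \<tau> (w$2) * sin (d * w$2))) *\<^sub>R (q * v)
    + ((?g \<sigma> (w$1) * sin (c * w$1)) * (?g \<tau> (w$2) * cos (d * w$2))) *\<^sub>R (u * q)
    + ((?g \<sigma> (w$1) * sin (c * w$1)) * (?g \<tau> (w$2) * sin (d * w$2))) *\<^sub>R (u * q * v)
    = gauss_weight \<sigma> \<tau> w *\<^sub>R (qcis u (c * w$1) * q * qcis v (d * w$2))" for w :: "real^2"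
    by (simp add: gauss_weight_def qcis_conv algebra_simps)
  moreover have "((\<sigma> * sqrt (2 * pi) * exp (- (c * \<sigma>)\<^sup>2 / 2)) * (\<tau> * sqrt (2 * pi) * exp (- (d * \<tau>)\<^sup>2 / 2))) *\<^sub>R q
      + 0 *\<^sub>R (q * v) + 0 *\<^sub>R (u * q) + 0 *\<^sub>R (u * q * v)
    = (2 * pi * \<sigma> * \<tau> * exp (- ((c * \<sigma>)\<^sup>2 + (d * \<tau>)\<^sup>2) / 2)) *\<^sub>R q"
    by (simp add: exp_add[symmetric] algebra_simps add_divide_distrib diff_divide_distrib)
  ultimately show ?thesis
    by (simp only:)
qed

section \<open>The two-sided Fourier transform\<close>

lemma borel_measurable_vec_nth [measurable (raw)]:
  fixes g :: "'a \<Rightarrow> real^'n"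
  assumes "g \<in> borel_measurable M"
  shows "(\<lambda>x. g x $ i) \<in> borel_measurable M"
  using measurable_compose[OF assms borel_measurable_nth] .

lemma integrable_pair_prod:
  fixes f :: "'a \<Rightarrow> real" and g :: "'b \<Rightarrow> real"
  assumes "sigma_finite_measure M" "sigma_finite_measure N"
    and f: "integrable M f" and g: "integrable N g"
  shows "integrable (M \<Otimes>\<^sub>M N) (\<lambda>z. f (fst z) * g (snd z))"
proof -
  interpret pair_sigma_finite M N
    using assms by (simp add: pair_sigma_finite_def)
  have [measurable]: "f \<in> borel_measurable M" "g \<in> borel_measurable N"
    using f g by auto
  show ?thesis
    using f g by (intro Fubini_integrable) (simp_all add: abs_mult)
qed

text \<open>\<open>dot_norm\<close> expresses the inner product through norms, and the norm of
  quaternions is multiplicative.\<close>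

lemma inner_mult_unit_left:
  fixes a p q :: quat
  assumes "norm a = 1"
  shows "(a * p) \<bullet> (a * q) = p \<bullet> q"
  by (simp add: dot_norm norm_mult assms flip: distrib_left)

lemma inner_mult_unit_right:
  fixes a p q :: quat
  assumes "norm a = 1"
  shows "(p * a) \<bullet> (q * a) = p \<bullet> q"
  by (simp add: dot_norm norm_mult assms flip: distrib_right)

text \<open>Takes the place of multiplying an exponential by a conjugate one. Each phase of the
  first argument is split into the phase of the second and a difference, with the shared unit placed
  outermost; invariance of the inner product then strips it on the left and on the right.\<close>

lemma inner_qcis_shift:
  assumes "u * u = -1" "v * v = -1"
  shows "(qcis u s * p * qcis v t) \<bullet> (qcis u s' * q * qcis v t')
    = (qcis u (s - s') * p * qcis v (t - t')) \<bullet> q"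
proof -
  have s: "qcis u s = qcis u s' * qcis u (s - s')" and t: "qcis v t = qcis v (t - t') * qcis v t'"
    using qcis_add[OF assms(1), of s' "s - s'"] qcis_add[OF assms(2), of "t - t'" t'] by simp_all
  show ?thesis
    unfolding s t
    using inner_mult_unit_left[OF norm_qcis[OF assms(1)], of s' "qcis u (s - s') * p * qcis v (t - t')" q]
      inner_mult_unit_right[OF norm_qcis[OF assms(2)], of "qcis u s' * (qcis u (s - s') * p * qcis v (t - t'))" t' "qcis u s' * q"]
    by (simp add: mult.assoc)
qed

lemma lborel_integral_reflect_scale:
  fixes g :: "real^2 \<Rightarrow> real"
  assumes [measurable]: "g \<in> borel_measurable borel" and "r > 0"
  shows "(\<integral>z. g (x - z /\<^sub>R r) \<partial>lborel) = r\<^sup>2 * (\<integral>y. g y \<partial>lborel)"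
proof -
  have "(\<integral>y. g y \<partial>lborel)
      = (\<integral>y. g y \<partial>density (distr lborel borel (\<lambda>z. x + (- inverse r) *\<^sub>R z)) (\<lambda>_. ennreal (\<bar>- inverse r\<bar> ^ DIM(real^2))))"
    using \<open>r > 0\<close> by (subst lborel_affine[of "- inverse r" x]) simp_all
  also have "\<dots> = (inverse r)\<^sup>2 * (\<integral>z. g (x - z /\<^sub>R r) \<partial>lborel)"
    using \<open>r > 0\<close> by (subst integral_density) (simp_all add: integral_distr)
  finally show ?thesis
    using \<open>r > 0\<close> by (simp add: field_simps)
qed

definition two_sided_ft ::
  "quat \<Rightarrow> quat \<Rightarrow> real \<Rightarrow> real \<Rightarrow> (real^2 \<Rightarrow> quat) \<Rightarrow> real^2 \<Rightarrow> quat" where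
  "two_sided_ft u v b c H w =
    (\<integral>x. qcis u (- (x$1 * w$1 / b)) * H x * qcis v (- (x$2 * w$2 / c)) \<partial>lborel)"

context
  fixes u v :: quat and b c :: real and H :: "real^2 \<Rightarrow> quat"
  assumes uv: "u * u = -1" "v * v = -1"
    and bc: "b \<noteq> 0" "c \<noteq> 0"
    and H_meas [measurable]: "H \<in> borel_measurable borel"
    and H_int: "integrable lborel H"
begin

private definition E :: "real^2 \<Rightarrow> real^2 \<Rightarrow> quat" where
  "E w x = qcis u (- (x$1 * w$1 / b)) * H x * qcis v (- (x$2 * w$2 / c))"

private lemma norm_E: "norm (E w x) = norm (H x)"
  by (simp add: E_def norm_mult norm_qcis uv)

private lemma E_meas [measurable]: "(\<lambda>(w, x). E w x) \<in> borel_measurable (borel \<Otimes>\<^sub>M borel)"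
  unfolding E_def by measurable

private lemma E_int: "integrable lborel (E w)"
proof (rule Bochner_Integration.integrable_bound[OF H_int])
  show "E w \<in> borel_measurable lborel"
    unfolding E_def by measurable
qed (simp add: norm_E)

private lemma ft_E: "two_sided_ft u v b c H w = (\<integral>x. E w x \<partial>lborel)"
  by (simp add: two_sided_ft_def E_def)

lemma measurable_two_sided_ft: "two_sided_ft u v b c H \<in> borel_measurable borel"
  unfolding ft_E[abs_def] by measurable

lemma norm_two_sided_ft_le: "norm (two_sided_ft u v b c H w) \<le> (\<integral>x. norm (H x) \<partial>lborel)"
  unfolding ft_E using integral_norm_bound[of lborel "E w"] by (simp add: norm_E)

private lemma H_pair_int: "integrable (lborel :: ((real^2) \<times> (real^2)) measure) (\<lambda>(x, x'). norm (H x) * norm (H x'))"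
  using integrable_pair_prod[OF sigma_finite_lborel sigma_finite_lborel
      integrable_norm[OF H_int] integrable_norm[OF H_int]]
  by (simp add: lborel_prod case_prod_unfold)

private lemma E_pair_int: "integrable (lborel :: ((real^2) \<times> (real^2)) measure) (\<lambda>(x, x'). E w x \<bullet> E w x')"
proof (rule Bochner_Integration.integrable_bound[OF H_pair_int])
  have "(\<lambda>(x, x'). E w x \<bullet> E w x') \<in> borel_measurable (lborel \<Otimes>\<^sub>M lborel)"
    by measurable
  then show "(\<lambda>(x, x'). E w x \<bullet> E w x') \<in> borel_measurable (lborel :: ((real^2) \<times> (real^2)) measure)"
    by (simp only: lborel_prod)
  show "AE z in lborel. norm (case z of (x, x') \<Rightarrow> E w x \<bullet> E w x') \<le> norm (case z of (x, x') \<Rightarrow> norm (H x) * norm (H x'))"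
    using Cauchy_Schwarz_ineq2 by (intro AE_I2) (simp add: norm_E[symmetric, of _ w] split_beta)
qed

private lemma norm_ft_square:
  "(norm (two_sided_ft u v b c H w))\<^sup>2 = (\<integral>z. E w (fst z) \<bullet> E w (snd z) \<partial>lborel)"
proof -
  have "(norm (two_sided_ft u v b c H w))\<^sup>2 = (\<integral>x. E w x \<partial>lborel) \<bullet> (\<integral>x'. E w x' \<partial>lborel)"
    by (simp add: ft_E power2_norm_eq_inner)
  also have "\<dots> = (\<integral>x. (\<integral>x'. E w x \<bullet> E w x' \<partial>lborel) \<partial>lborel)"
    by (simp add: E_int)
  also have "\<dots> = (\<integral>z. (case z of (x, x') \<Rightarrow> E w x \<bullet> E w x') \<partial>(lborel \<Otimes>\<^sub>M lborel))"
    using lborel_pair.integral_fst'[of "\<lambda>(x, x'). E w x \<bullet> E w x'"] E_pair_int[of w]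
    by (simp add: lborel_prod)
  finally show ?thesis
    by (simp add: lborel_prod split_beta)
qed

text \<open>The squared transform is a double integral over \<open>x\<close> and \<open>x'\<close>,
  and the weight is integrated first. Widths proportional to \<open>\<bar>b\<bar>\<close> and
  \<open>\<bar>c\<bar>\<close> cancel the divisions by \<open>b\<close> and \<open>c\<close> in the
  phases, so the resulting Gaussian depends on the Euclidean length of \<open>x - x'\<close>
  alone.\<close>

private lemma gauss_ft:
  fixes \<sigma> :: real
  assumes "\<sigma> > 0"
  shows "has_bochner_integral lborel
      (\<lambda>w. gauss_weight (\<sigma> * \<bar>b\<bar>) (\<sigma> * \<bar>c\<bar>) w * (norm (two_sided_ft u v b c H w))\<^sup>2)
      (\<integral>z. 2 * pi * \<sigma>\<^sup>2 * \<bar>b * c\<bar> * exp (- (\<sigma> * norm (fst z - snd z))\<^sup>2 / 2) * (H (fst z) \<bullet> H (snd z)) \<partial>lborel)"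
proof -
  let ?W = "gauss_weight (\<sigma> * \<bar>b\<bar>) (\<sigma> * \<bar>c\<bar>)"
  have pos: "\<sigma> * \<bar>b\<bar> > 0" "\<sigma> * \<bar>c\<bar> > 0"
    using assms bc by simp_all
  have Wint: "integrable lborel ?W"
    using gauss_weight_integral[OF pos] by (rule integrable.intros)
  let ?\<Phi> = "\<lambda>(w, z). ?W w * (E w (fst z) \<bullet> E w (snd z))"
  \<comment> \<open>The majorant is a product of three integrable functions, one for each of
    \<open>w\<close>, \<open>x\<close> and \<open>x'\<close>; the weight provides integrability in
    \<open>w\<close>.\<close>
  have \<Phi>_int: "integrable (lborel \<Otimes>\<^sub>M (lborel :: ((real^2) \<times> (real^2)) measure)) ?\<Phi>"
  proof (rule Bochner_Integration.integrable_bound)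
    show "integrable (lborel \<Otimes>\<^sub>M (lborel :: ((real^2) \<times> (real^2)) measure))
        (\<lambda>y. ?W (fst y) * (case snd y of (x, x') \<Rightarrow> norm (H x) * norm (H x')))"
      by (intro integrable_pair_prod sigma_finite_lborel Wint H_pair_int)
    have "?\<Phi> \<in> borel_measurable (borel \<Otimes>\<^sub>M (borel \<Otimes>\<^sub>M borel))"
      by measurable
    then show "?\<Phi> \<in> borel_measurable (lborel \<Otimes>\<^sub>M (lborel :: ((real^2) \<times> (real^2)) measure))"
      by (simp add: borel_prod lborel_prod)
    show "AE y in lborel \<Otimes>\<^sub>M (lborel :: ((real^2) \<times> (real^2)) measure). norm (?\<Phi> y)
        \<le> norm (?W (fst y) * (case snd y of (x, x') \<Rightarrow> norm (H x) * norm (H x')))"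
    proof (rule AE_I2)
      fix y :: "(real^2) \<times> (real^2) \<times> (real^2)"
      obtain w x x' where y: "y = (w, x, x')"
        by (cases y) auto
      show "norm (?\<Phi> y) \<le> norm (?W (fst y) * (case snd y of (x, x') \<Rightarrow> norm (H x) * norm (H x')))"
        using Cauchy_Schwarz_ineq2[of "E w x" "E w x'"] gauss_weight_bounds[of "\<sigma> * \<bar>b\<bar>" "\<sigma> * \<bar>c\<bar>" w]
        by (simp add: y abs_mult norm_E mult_left_mono)
    qed
  qed
  have inner_w: "(\<integral>w. ?W w * (E w x \<bullet> E w x') \<partial>lborel)
      = 2 * pi * \<sigma>\<^sup>2 * \<bar>b * c\<bar> * exp (- (\<sigma> * norm (x - x'))\<^sup>2 / 2) * (H x \<bullet> H x')" for x x'
  proof -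
    define s t where "s = (x'$1 - x$1) / b" and "t = (x'$2 - x$2) / c"
    have "(s * (\<sigma> * \<bar>b\<bar>))\<^sup>2 + (t * (\<sigma> * \<bar>c\<bar>))\<^sup>2 = \<sigma>\<^sup>2 * ((x'$1 - x$1)\<^sup>2 + (x'$2 - x$2)\<^sup>2)"
      using bc by (simp add: s_def t_def power_mult_distrib power_divide distrib_left)
    also have "\<dots> = (\<sigma> * norm (x - x'))\<^sup>2"
      by (simp add: power_mult_distrib norm_vec_def L2_set_def UNIV_2 power2_commute)
    finally have ex: "(s * (\<sigma> * \<bar>b\<bar>))\<^sup>2 + (t * (\<sigma> * \<bar>c\<bar>))\<^sup>2 = (\<sigma> * norm (x - x'))\<^sup>2" .
    have "E w x \<bullet> E w x' = (qcis u (s * w$1) * H x * qcis v (t * w$2)) \<bullet> H x'" for w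
    proof -
      have st: "- (x$1 * w$1 / b) - - (x'$1 * w$1 / b) = s * w$1"
        "- (x$2 * w$2 / c) - - (x'$2 * w$2 / c) = t * w$2"
        by (simp_all add: s_def t_def diff_divide_distrib left_diff_distrib)
      show ?thesis
        unfolding E_def inner_qcis_shift[OF uv] st ..
    qed
    then have "(\<lambda>w. ?W w * (E w x \<bullet> E w x')) = (\<lambda>w. (?W w *\<^sub>R (qcis u (s * w$1) * H x * qcis v (t * w$2))) \<bullet> H x')"
      by simp
    moreover have "has_bochner_integral lborel \<dots>
        (((2 * pi * (\<sigma> * \<bar>b\<bar>) * (\<sigma> * \<bar>c\<bar>) * exp (- (\<sigma> * norm (x - x'))\<^sup>2 / 2)) *\<^sub>R H x) \<bullet> H x')"
      unfolding ex[symmetric]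
      by (intro has_bochner_integral_inner_left gauss_weight_two_sided pos)
    ultimately show ?thesis
      by (simp add: has_bochner_integral_iff power2_eq_square abs_mult mult_ac)
  qed
  have "(\<integral>w. ?W w * (norm (two_sided_ft u v b c H w))\<^sup>2 \<partial>lborel)
      = (\<integral>w. (\<integral>z. ?W w * (E w (fst z) \<bullet> E w (snd z)) \<partial>lborel) \<partial>lborel)"
    by (simp add: norm_ft_square)
  also have "\<dots> = (\<integral>z. (\<integral>w. ?W w * (E w (fst z) \<bullet> E w (snd z)) \<partial>lborel) \<partial>lborel)"
    by (rule lborel_pair.Fubini_integral[symmetric]) (use \<Phi>_int in simp)
  finally have val: "(\<integral>w. ?W w * (norm (two_sided_ft u v b c H w))\<^sup>2 \<partial>lborel) = \<dots>" .
  have "integrable lborel (\<lambda>w. \<integral>z. ?\<Phi> (w, z) \<partial>lborel)"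
    using lborel_pair.integrable_fst'[OF \<Phi>_int] .
  then have "integrable lborel (\<lambda>w. ?W w * (norm (two_sided_ft u v b c H w))\<^sup>2)"
    by (simp add: norm_ft_square)
  then show ?thesis
    using val by (simp add: has_bochner_integral_iff inner_w)
qed

section \<open>Autocorrelation of an integrable and square integrable signal\<close>

context
  assumes H_L2: "integrable lborel (\<lambda>x. (norm (H x))\<^sup>2)"
begin

private lemma H_shift_L2: "integrable lborel (\<lambda>x. (norm (H (x - h)))\<^sup>2)"
  using lborel_integral_translate(2)[of "\<lambda>x. (norm (H x))\<^sup>2" h] H_L2 by simp

private lemma H_shift_inner_int:
  "integrable lborel (\<lambda>x. H x \<bullet> H (x - h))" "integrable lborel (\<lambda>x. norm (H x) * norm (H (x - h)))"
  by (intro integrable_inner_L2 H_L2 H_shift_L2; measurable)+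

text \<open>Arithmetic-geometric mean and translation invariance. The bound is uniform in
  \<open>h\<close>, which is what both the exchange of integrals and the dominated limit below rely
  on.\<close>

private lemma H_shift_norm_le: "(\<integral>x. norm (H x) * norm (H (x - h)) \<partial>lborel) \<le> (\<integral>x. (norm (H x))\<^sup>2 \<partial>lborel)"
proof -
  have "(\<integral>x. norm (H x) * norm (H (x - h)) \<partial>lborel)
      \<le> (\<integral>x. ((norm (H x))\<^sup>2 + (norm (H (x - h)))\<^sup>2) / 2 \<partial>lborel)"
  proof (rule integral_mono)
    show "norm (H x) * norm (H (x - h)) \<le> ((norm (H x))\<^sup>2 + (norm (H (x - h)))\<^sup>2) / 2" for x
      using sum_squares_bound[of "norm (H x)" "norm (H (x - h))"] by simp
  qed (use H_L2 H_shift_L2 H_shift_inner_int in auto)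
  also have "\<dots> = (\<integral>x. (norm (H x))\<^sup>2 \<partial>lborel)"
    using lborel_integral_translate(1)[of "\<lambda>x. (norm (H x))\<^sup>2" h] H_L2 H_shift_L2 by simp
  finally show ?thesis .
qed

private lemma autocorrelation_bound: "\<bar>\<integral>x. H x \<bullet> H (x - h) \<partial>lborel\<bar> \<le> (\<integral>x. (norm (H x))\<^sup>2 \<partial>lborel)"
proof -
  have "\<bar>\<integral>x. H x \<bullet> H (x - h) \<partial>lborel\<bar> \<le> (\<integral>x. norm (H x) * norm (H (x - h)) \<partial>lborel)"
    using integral_abs_bound_integral[OF H_shift_inner_int, of h h] Cauchy_Schwarz_ineq2 by blast
  then show ?thesis
    using H_shift_norm_le by (rule order_trans)
qed

private lemma gauss_11: "gauss_weight 1 1 z = exp (- (norm z)\<^sup>2 / 2)"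
  by (simp add: gauss_weight_def norm_vec_def L2_set_def UNIV_2 add_divide_distrib diff_divide_distrib
      flip: exp_add)

private lemma gauss_11_int: "integrable lborel (gauss_weight 1 1)"
  and gauss_11_val: "(\<integral>z. gauss_weight 1 1 z \<partial>lborel) = 2 * pi"
  using gauss_weight_integral[of 1 1] by (simp_all add: has_bochner_integral_iff)

text \<open>For fixed \<open>x\<close> the substitution \<open>y = x - z /\<^sub>R \<sigma>\<close>
  absorbs the factor \<open>\<sigma>\<^sup>2\<close> as Jacobian. The narrowing Gaussian becomes the
  fixed weight \<open>gauss_weight 1 1\<close>, and the dependence on \<open>\<sigma>\<close> moves
  into a shift that tends to 0 as \<open>\<sigma>\<close> grows.\<close>

private lemma gauss_correlation:
  fixes \<sigma> :: real
  assumes "\<sigma> > 0"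
  shows "(\<integral>z. 2 * pi * \<sigma>\<^sup>2 * \<bar>b * c\<bar> * exp (- (\<sigma> * norm (fst z - snd z))\<^sup>2 / 2) * (H (fst z) \<bullet> H (snd z)) \<partial>lborel)
    = 2 * pi * \<bar>b * c\<bar> * (\<integral>z. gauss_weight 1 1 z * (\<integral>x. H x \<bullet> H (x - z /\<^sub>R \<sigma>) \<partial>lborel) \<partial>lborel)"
proof -
  let ?C = "2 * pi * \<bar>b * c\<bar>"
  let ?g = "\<lambda>x y. exp (- (\<sigma> * norm (x - y))\<^sup>2 / 2) * (H x \<bullet> H y)"
  let ?\<Psi> = "\<lambda>z x. gauss_weight 1 1 z * (H x \<bullet> H (x - z /\<^sub>R \<sigma>))"
  have g_int: "integrable (lborel \<Otimes>\<^sub>M lborel) (\<lambda>(x, y). ?g x y)"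
  proof (rule Bochner_Integration.integrable_bound)
    show "integrable (lborel \<Otimes>\<^sub>M lborel) (\<lambda>(x, x'). norm (H x) * norm (H x'))"
      using H_pair_int by (simp add: lborel_prod)
    have "(\<lambda>(x, y). ?g x y) \<in> borel_measurable (borel \<Otimes>\<^sub>M borel)"
      by measurable
    then show "(\<lambda>(x, y). ?g x y) \<in> borel_measurable (lborel \<Otimes>\<^sub>M lborel)"
      by (simp add: borel_prod lborel_prod)
    show "AE z in lborel \<Otimes>\<^sub>M lborel. norm (case z of (x, y) \<Rightarrow> ?g x y)
        \<le> norm (case z of (x, x') \<Rightarrow> norm (H x) * norm (H x'))"
    proof (rule AE_I2)
      fix z :: "(real^2) \<times> (real^2)"
      obtain x y where z: "z = (x, y)" by (cases z)
      have "\<bar>?g x y\<bar> \<le> 1 * (norm (H x) * norm (H y))"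
        unfolding abs_mult using Cauchy_Schwarz_ineq2 by (intro mult_mono) auto
      then show "norm (case z of (x, y) \<Rightarrow> ?g x y)
        \<le> norm (case z of (x, x') \<Rightarrow> norm (H x) * norm (H x'))"
        by (simp add: z)
    qed
  qed
  have \<Psi>_meas: "(\<lambda>(z, x). ?\<Psi> z x) \<in> borel_measurable (lborel \<Otimes>\<^sub>M lborel)"
  proof -
    have "(\<lambda>(z, x). ?\<Psi> z x) \<in> borel_measurable (borel \<Otimes>\<^sub>M borel)"
      by measurable
    then show ?thesis
      by (simp add: borel_prod lborel_prod)
  qed
  \<comment> \<open>Integrating over \<open>x\<close> first leaves at most the weight times the
    squared norm of \<open>H\<close>; here square integrability enters.\<close>
  have \<Psi>_int: "integrable (lborel \<Otimes>\<^sub>M lborel) (\<lambda>(z, x). ?\<Psi> z x)"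
  proof (rule lborel_pair.Fubini_integrable[OF \<Psi>_meas])
    show "integrable lborel (\<lambda>z. \<integral>x. norm (case (z, x) of (z, x) \<Rightarrow> ?\<Psi> z x) \<partial>lborel)"
    proof (rule Bochner_Integration.integrable_bound)
      show "integrable lborel (\<lambda>z. gauss_weight 1 1 z * (\<integral>x. (norm (H x))\<^sup>2 \<partial>lborel))"
        using gauss_11_int by simp
      show "(\<lambda>z. \<integral>x. norm (case (z, x) of (z, x) \<Rightarrow> ?\<Psi> z x) \<partial>lborel) \<in> borel_measurable lborel"
        using \<Psi>_meas by measurable
      show "AE z in lborel. norm (\<integral>x. norm (case (z, x) of (z, x) \<Rightarrow> ?\<Psi> z x) \<partial>lborel)
          \<le> norm (gauss_weight 1 1 z * (\<integral>x. (norm (H x))\<^sup>2 \<partial>lborel))"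
      proof (rule AE_I2)
        fix z :: "real^2"
        have "(\<integral>x. \<bar>H x \<bullet> H (x - z /\<^sub>R \<sigma>)\<bar> \<partial>lborel)
            \<le> (\<integral>x. norm (H x) * norm (H (x - z /\<^sub>R \<sigma>)) \<partial>lborel)"
          using Cauchy_Schwarz_ineq2 H_shift_inner_int by (intro integral_mono) auto
        also have "\<dots> \<le> (\<integral>x. (norm (H x))\<^sup>2 \<partial>lborel)"
          by (rule H_shift_norm_le)
        finally show "norm (\<integral>x. norm (case (z, x) of (z, x) \<Rightarrow> ?\<Psi> z x) \<partial>lborel)
          \<le> norm (gauss_weight 1 1 z * (\<integral>x. (norm (H x))\<^sup>2 \<partial>lborel))"
          by (simp add: abs_mult mult_left_mono gauss_weight_bounds)
      qed
    qed
    show "AE z in lborel. integrable lborel (\<lambda>x. case (z, x) of (z, x) \<Rightarrow> ?\<Psi> z x)"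
      using H_shift_inner_int by (intro AE_I2) simp
  qed
  have "(\<integral>z. 2 * pi * \<sigma>\<^sup>2 * \<bar>b * c\<bar> * exp (- (\<sigma> * norm (fst z - snd z))\<^sup>2 / 2) * (H (fst z) \<bullet> H (snd z)) \<partial>lborel)
      = (\<integral>z. ?C * \<sigma>\<^sup>2 * (case z of (x, y) \<Rightarrow> ?g x y) \<partial>(lborel \<Otimes>\<^sub>M lborel))"
    by (simp add: lborel_prod split_beta mult_ac)
  also have "\<dots> = ?C * \<sigma>\<^sup>2 * (\<integral>z. (case z of (x, y) \<Rightarrow> ?g x y) \<partial>(lborel \<Otimes>\<^sub>M lborel))"
    by (rule integral_mult_right_zero)
  also have "(\<integral>z. (case z of (x, y) \<Rightarrow> ?g x y) \<partial>(lborel \<Otimes>\<^sub>M lborel)) = (\<integral>x. (\<integral>y. ?g x y \<partial>lborel) \<partial>lborel)"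
    using lborel_pair.integral_fst'[OF g_int] by simp
  also have "?C * \<sigma>\<^sup>2 * \<dots> = ?C * (\<integral>x. \<sigma>\<^sup>2 * (\<integral>y. ?g x y \<partial>lborel) \<partial>lborel)"
    by simp
  also have "(\<integral>x. \<sigma>\<^sup>2 * (\<integral>y. ?g x y \<partial>lborel) \<partial>lborel) = (\<integral>x. (\<integral>z. ?\<Psi> z x \<partial>lborel) \<partial>lborel)"
  proof (rule Bochner_Integration.integral_cong[OF refl])
    fix x
    have "\<sigma>\<^sup>2 * (\<integral>y. ?g x y \<partial>lborel) = (\<integral>z. ?g x (x - z /\<^sub>R \<sigma>) \<partial>lborel)"
      by (rule lborel_integral_reflect_scale[symmetric]) (use assms in measurable)
    also have "\<dots> = (\<integral>z. ?\<Psi> z x \<partial>lborel)"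
      using assms by (simp add: gauss_11 flip: mult.assoc)
    finally show "\<sigma>\<^sup>2 * (\<integral>y. ?g x y \<partial>lborel) = (\<integral>z. ?\<Psi> z x \<partial>lborel)" .
  qed
  also have "\<dots> = (\<integral>z. (\<integral>x. ?\<Psi> z x \<partial>lborel) \<partial>lborel)"
    by (rule lborel_pair.Fubini_integral[OF \<Psi>_int])
  finally show ?thesis
    by simp
qed

text \<open>The autocorrelation is largest at shift 0, so the pointwise limit is itself the
  majorant; \<open>2 * pi\<close> is the mass of \<open>gauss_weight 1 1\<close>.\<close>

private lemma gauss_correlation_tendsto:
  "(\<lambda>n. \<integral>z. gauss_weight 1 1 z * (\<integral>x. H x \<bullet> H (x - z /\<^sub>R real (Suc n)) \<partial>lborel) \<partial>lborel)
    \<longlonglongrightarrow> 2 * pi * (\<integral>x. (norm (H x))\<^sup>2 \<partial>lborel)"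
proof -
  let ?N = "\<integral>x. (norm (H x))\<^sup>2 \<partial>lborel"
  have "(\<lambda>n. \<integral>z. gauss_weight 1 1 z * (\<integral>x. H x \<bullet> H (x - z /\<^sub>R real (Suc n)) \<partial>lborel) \<partial>lborel)
    \<longlonglongrightarrow> (\<integral>z. gauss_weight 1 1 z * ?N \<partial>lborel)"
  proof (rule integral_dominated_convergence[where w = "\<lambda>z. gauss_weight 1 1 z * ?N"])
    show "integrable lborel (\<lambda>z. gauss_weight 1 1 z * ?N)"
      using gauss_11_int by simp
    show "AE z in lborel. (\<lambda>n. gauss_weight 1 1 z * (\<integral>x. H x \<bullet> H (x - z /\<^sub>R real (Suc n)) \<partial>lborel))
        \<longlonglongrightarrow> gauss_weight 1 1 z * ?N"
    proof (rule AE_I2)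
      fix z :: "real^2"
      have "(\<lambda>n. inverse (real (Suc n)) *\<^sub>R z) \<longlonglongrightarrow> 0 *\<^sub>R z"
        by (intro tendsto_intros LIMSEQ_inverse_real_of_nat)
      then have "(\<lambda>n. \<integral>x. H x \<bullet> H (x - z /\<^sub>R real (Suc n)) \<partial>lborel) \<longlonglongrightarrow> ?N"
        by (intro L2_autocorrelation_tendsto H_L2 H_meas) simp
      then show "(\<lambda>n. gauss_weight 1 1 z * (\<integral>x. H x \<bullet> H (x - z /\<^sub>R real (Suc n)) \<partial>lborel))
        \<longlonglongrightarrow> gauss_weight 1 1 z * ?N"
        by (intro tendsto_intros)
    qed
    show "AE z in lborel. norm (gauss_weight 1 1 z * (\<integral>x. H x \<bullet> H (x - z /\<^sub>R real (Suc n)) \<partial>lborel))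
        \<le> gauss_weight 1 1 z * ?N" for n
      using autocorrelation_bound by (intro AE_I2) (simp add: abs_mult gauss_weight_bounds mult_left_mono)
  qed measurable
  then show ?thesis
    by (simp add: gauss_11_val)
qed

text \<open>One factor \<open>2 * pi\<close> comes from the Gaussian weight in frequency, the other
  from the mass of the limiting weight in \<open>z\<close>. The right-hand side is an extended
  nonnegative integral, so each weighted integral lies below it by monotonicity, and so does their
  limit.\<close>

theorem two_sided_ft_L2_lower_bound:
  "ennreal ((2 * pi)\<^sup>2 * \<bar>b * c\<bar> * (\<integral>x. (norm (H x))\<^sup>2 \<partial>lborel))
    \<le> (\<integral>\<^sup>+w. ennreal ((norm (two_sided_ft u v b c H w))\<^sup>2) \<partial>lborel)"
proof -
  let ?J = "\<lambda>n. \<integral>z. gauss_weight 1 1 z * (\<integral>x. H x \<bullet> H (x - z /\<^sub>R real (Suc n)) \<partial>lborel) \<partial>lborel"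
  have "ennreal (2 * pi * \<bar>b * c\<bar> * ?J n)
      \<le> (\<integral>\<^sup>+w. ennreal ((norm (two_sided_ft u v b c H w))\<^sup>2) \<partial>lborel)" for n
  proof -
    let ?W = "gauss_weight (real (Suc n) * \<bar>b\<bar>) (real (Suc n) * \<bar>c\<bar>)"
    have J: "has_bochner_integral lborel (\<lambda>w. ?W w * (norm (two_sided_ft u v b c H w))\<^sup>2) (2 * pi * \<bar>b * c\<bar> * ?J n)"
      using gauss_ft[of "real (Suc n)"] gauss_correlation[of "real (Suc n)"] by (simp only: of_nat_0_less_iff zero_less_Suc)
    then have "ennreal (2 * pi * \<bar>b * c\<bar> * ?J n) = (\<integral>\<^sup>+w. ennreal (?W w * (norm (two_sided_ft u v b c H w))\<^sup>2) \<partial>lborel)"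
      by (subst nn_integral_eq_integral) (simp_all add: has_bochner_integral_iff gauss_weight_bounds)
    also have "\<dots> \<le> (\<integral>\<^sup>+w. ennreal ((norm (two_sided_ft u v b c H w))\<^sup>2) \<partial>lborel)"
      by (intro nn_integral_mono ennreal_leI mult_left_le_one_le) (simp_all add: gauss_weight_bounds)
    finally show ?thesis .
  qed
  moreover have "(\<lambda>n. ennreal (2 * pi * \<bar>b * c\<bar> * ?J n))
      \<longlonglongrightarrow> ennreal (2 * pi * \<bar>b * c\<bar> * (2 * pi * (\<integral>x. (norm (H x))\<^sup>2 \<partial>lborel)))"
    by (intro tendsto_ennrealI tendsto_mult_left gauss_correlation_tendsto)
  ultimately have "ennreal (2 * pi * \<bar>b * c\<bar> * (2 * pi * (\<integral>x. (norm (H x))\<^sup>2 \<partial>lborel)))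
      \<le> (\<integral>\<^sup>+w. ennreal ((norm (two_sided_ft u v b c H w))\<^sup>2) \<partial>lborel)"
    by (intro LIMSEQ_le_const2) auto
  then show ?thesis
    by (simp add: power2_eq_square mult_ac)
qed

end

end

section \<open>Moments of the Gabor transform\<close>

text \<open>Signal and window are merely Lebesgue measurable, whereas joint measurability is argued
  over Borel sets; this supplies Borel representatives. The real case is applied to each coordinate,
  and finitely many null sets have a null union.\<close>

lemma lebesgue_ex_borel_AE_eq:
  fixes f :: "'a::euclidean_space \<Rightarrow> 'b::euclidean_space"
  assumes "f \<in> borel_measurable lebesgue"
  shows "\<exists>g\<in>borel_measurable borel. AE x in lborel. f x = g x"
proof -
  have "\<exists>g\<in>borel_measurable lborel. AE x in lborel. f x \<bullet> b = g x" for b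
    using assms by (intro completion_ex_borel_measurable_real) auto
  then obtain g where g: "\<And>b. g b \<in> borel_measurable lborel" "\<And>b. AE x in lborel. f x \<bullet> b = g b x"
    by metis
  have "AE x in lborel. \<forall>b\<in>Basis. f x \<bullet> b = g b x"
    using g(2) by (intro AE_finite_allI) auto
  then have "AE x in lborel. f x = (\<Sum>b\<in>Basis. g b x *\<^sub>R b)"
  proof eventually_elim
    case (elim x)
    then show ?case
      using euclidean_representation[of "f x"] by simp
  qed
  moreover have "(\<lambda>x. \<Sum>b\<in>Basis. g b x *\<^sub>R b) \<in> borel_measurable borel"
    using g(1) by simp
  ultimately show ?thesis
    by (rule bexI)
qed

lemma AE_lborel_translate:
  fixes h :: "'a::euclidean_space"
  assumes "AE x in lborel. P x"
  shows "AE x in lborel. P (x - h)"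
proof -
  have "AE x in distr lborel borel ((+) (- h)). P x"
    using assms by (simp only: lborel_distr_plus)
  from AE_distrD[OF _ this] show ?thesis
    by simp
qed

lemma nn_integral_lborel_reflect:
  fixes f :: "'a::euclidean_space \<Rightarrow> ennreal"
  assumes [measurable]: "f \<in> borel_measurable borel"
  shows "(\<integral>\<^sup>+y. f (x - y) \<partial>lborel) = (\<integral>\<^sup>+y. f y \<partial>lborel)"
proof -
  have "(\<integral>\<^sup>+y. f y \<partial>lborel)
      = (\<integral>\<^sup>+y. f y \<partial>density (distr lborel borel (\<lambda>y. x + (- 1) *\<^sub>R y)) (\<lambda>_. ennreal (\<bar>- 1\<bar> ^ DIM('a))))"
    by (subst lborel_affine[of "- 1" x]) simp_all
  also have "\<dots> = (\<integral>\<^sup>+y. f (x - y) \<partial>lborel)"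
    by (simp add: nn_integral_density nn_integral_distr)
  finally show ?thesis ..
qed

lemma measurable_lct_factor [measurable (raw)]:
  assumes [measurable]: "g \<in> borel_measurable M"
  shows "(\<lambda>x. lct_factor u A (g x)) \<in> borel_measurable M"
  unfolding lct_factor_def by measurable

lemma qi_qj_square: "qi * qi = -1" "qj * qj = -1"
  by (rule quat_units)+

lemma lct_kernel_measurable [measurable (raw)]:
  assumes "u * u = -1" and [measurable]: "g \<in> borel_measurable M" "h \<in> borel_measurable M"
  shows "(\<lambda>x. lct_kernel u A (g x) (h x)) \<in> borel_measurable M"
  unfolding lct_kernel_factorization(1)[OF assms(1)] by measurable

text \<open>A translate of a null set is null, so replacing the window is harmless for every
  \<open>y\<close>. The identity holds at every \<open>\<omega>\<close> and \<open>y\<close>, hence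
  pointwise bounds and Borel measurability pass to \<open>GQLCT\<close> itself.\<close>

lemma GQLCT_borel_representative:
  assumes f: "f \<in> borel_measurable lebesgue" and \<phi>: "\<phi> \<in> borel_measurable lebesgue"
    and [measurable]: "f' \<in> borel_measurable borel" "\<phi>' \<in> borel_measurable borel"
    and ff': "AE x in lborel. f x = f' x" and \<phi>\<phi>': "AE x in lborel. \<phi> x = \<phi>' x"
  shows "GQLCT A1 A2 \<phi> f \<omega> y =
    (\<integral>x. lct_kernel qi A1 (x$1) (\<omega>$1) * f' x * qcnj (\<phi>' (x - y)) * lct_kernel qj A2 (x$2) (\<omega>$2) \<partial>lborel)"
proof -
  let ?h = "\<lambda>x. lct_kernel qi A1 (x$1) (\<omega>$1) * f x * qcnj (\<phi> (x - y)) * lct_kernel qj A2 (x$2) (\<omega>$2)"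
  let ?h' = "\<lambda>x. lct_kernel qi A1 (x$1) (\<omega>$1) * f' x * qcnj (\<phi>' (x - y)) * lct_kernel qj A2 (x$2) (\<omega>$2)"
  have [measurable]: "(\<lambda>x::real^2. lct_kernel qi A1 (x$1) (\<omega>$1)) \<in> borel_measurable borel"
    "(\<lambda>x::real^2. lct_kernel qj A2 (x$2) (\<omega>$2)) \<in> borel_measurable borel"
    by (intro lct_kernel_measurable qi_qj_square; measurable)+
  have h'_borel: "?h' \<in> borel_measurable lborel"
    by measurable
  have AE: "AE x in lebesgue. ?h' x = ?h x"
    unfolding AE_completion_iff
    using ff' AE_lborel_translate[OF \<phi>\<phi>', of y] by eventually_elim simp
  have h': "?h' \<in> borel_measurable lebesgue"
    using h'_borel by (rule measurable_completion)
  have "integral\<^sup>L lebesgue ?h = integral\<^sup>L lebesgue ?h'"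
    using AE by (intro integral_cong_AE borel_measurable_AE[OF h' AE] h') (auto elim: eventually_mono)
  also have "\<dots> = integral\<^sup>L lborel ?h'"
    by (rule integral_completion[OF h'_borel])
  finally show ?thesis
    by (simp add: GQLCT_def)
qed

section \<open>The moment inequality for a bounded function of given mass\<close>

lemma ennsqrt_ennreal: "0 \<le> x \<Longrightarrow> ennsqrt (ennreal x) = ennreal (sqrt x)"
  by (simp add: ennsqrt_def)

lemma ennsqrt_eq_0_iff: "ennsqrt x = 0 \<longleftrightarrow> x = 0"
  by (cases x) (auto simp: ennsqrt_def)

lemma emeasure_cball_real2:
  "r \<ge> 0 \<Longrightarrow> emeasure lborel (cball (a :: real^2) r) = ennreal (pi * r\<^sup>2)"
  by (simp add: emeasure_cball unit_ball_vol_2)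

text \<open>With the product of the radii fixed, their ratio is chosen so that
  \<open>R powr (2 * s)\<close> and \<open>S powr (2 * s)\<close> are in the proportion
  \<open>m1\<close> to \<open>m2\<close>; this equalises the two quotients. The exponent
  \<open>1 / (4 * s)\<close> splits that proportion evenly between \<open>R\<close> and
  \<open>S\<close>.\<close>

lemma balanced_radii:
  fixes m1 m2 \<rho> s :: real
  assumes "m1 > 0" "m2 > 0" "\<rho> > 0" "s > 0"
  shows "\<exists>R>0. \<exists>S>0. R * S = \<rho> \<and> m1 / R powr (2 * s) = sqrt (m1 * m2) / \<rho> powr s
    \<and> m2 / S powr (2 * s) = sqrt (m1 * m2) / \<rho> powr s"
proof -
  define R S where "R = (m1 / m2) powr (1 / (4 * s)) * \<rho> powr (1/2)"
    and "S = (m2 / m1) powr (1 / (4 * s)) * \<rho> powr (1/2)"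
  have "R > 0" "S > 0"
    using assms by (simp_all add: R_def S_def)
  have "R * S = ((m1 / m2) * (m2 / m1)) powr (1 / (4 * s)) * (\<rho> powr (1/2) * \<rho> powr (1/2))"
    using assms by (simp add: R_def S_def powr_mult[symmetric] mult_ac del: powr_half_sqrt)
  also have "\<dots> = \<rho>"
    using assms by (simp flip: powr_add)
  finally have RS: "R * S = \<rho>" .
  have pR: "R powr (2 * s) = sqrt (m1 / m2) * \<rho> powr s"
    and pS: "S powr (2 * s) = sqrt (m2 / m1) * \<rho> powr s"
    using assms by (simp_all add: R_def S_def powr_mult powr_powr powr_half_sqrt[symmetric] del: powr_half_sqrt)
  have sq: "sqrt m1 * sqrt m1 = m1" "sqrt m2 * sqrt m2 = m2"
    using assms by simp_all
  have "m1 / sqrt (m1 / m2) = sqrt (m1 * m2)" "m2 / sqrt (m2 / m1) = sqrt (m1 * m2)"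
    using assms sq by (simp_all add: real_sqrt_divide real_sqrt_mult field_simps)
  then have "m1 / R powr (2 * s) = sqrt (m1 * m2) / \<rho> powr s" "m2 / S powr (2 * s) = sqrt (m1 * m2) / \<rho> powr s"
    unfolding pR pS by (simp_all flip: divide_divide_eq_left)
  with RS \<open>R > 0\<close> \<open>S > 0\<close> show ?thesis
    by blast
qed

text \<open>The constant \<open>\<rho>\<close> is the product of radii for which the box has measure
  \<open>(pi * \<rho>)\<^sup>2 = 1 / (2 * K)\<close>, so that it carries at most
  \<open>E / 2\<close>. The other half of the mass is bounded by two equal tails, whence the factor
  1/4.\<close>

lemma moment_product_lower_bound:
  fixes g :: "(real^2) \<times> (real^2) \<Rightarrow> real" and K E s :: real
  assumes g [measurable]: "g \<in> borel_measurable borel" and g0: "\<And>z. 0 \<le> g z"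
    and bound: "\<And>z. g z \<le> K * E" and mass: "ennreal E \<le> (\<integral>\<^sup>+z. ennreal (g z) \<partial>lborel)"
    and "K > 0" "s > 0" "E \<ge> 0"
  defines "\<rho> \<equiv> 1 / (pi * sqrt (2 * K))"
  shows "ennreal (\<rho> powr s / 4 * E)
    \<le> ennsqrt (\<integral>\<^sup>+z. ennreal (norm (fst z) powr (2 * s) * g z) \<partial>lborel)
      * ennsqrt (\<integral>\<^sup>+z. ennreal (norm (snd z) powr (2 * s) * g z) \<partial>lborel)"
proof (cases "E = 0")
  case True
  then show ?thesis by simp
next
  case False
  with \<open>E \<ge> 0\<close> have "E > 0" by simp
  have "\<rho> > 0"
    using \<open>K > 0\<close> by (simp add: \<rho>_def)
  define M where "M p = (\<integral>\<^sup>+z. ennreal (norm (p z) powr (2 * s) * g z) \<partial>lborel)"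
    for p :: "(real^2) \<times> (real^2) \<Rightarrow> real^2"
  \<comment> \<open>An infinite moment settles the claim only if the other one is nonzero, because
    \<open>top * 0 = 0\<close> in \<open>ennreal\<close>. A zero moment would make \<open>g\<close>
    vanish almost everywhere, against the mass bound.\<close>
  have nonzero: "M p \<noteq> 0" if [measurable]: "p \<in> borel_measurable borel" and AEp: "AE z in lborel. p z \<noteq> 0" for p
  proof
    assume "M p = 0"
    then have "AE z in lborel. ennreal (norm (p z) powr (2 * s) * g z) = 0"
      unfolding M_def by (subst (asm) nn_integral_0_iff_AE) measurable
    with AEp have "AE z in lborel. ennreal (g z) = 0"
    proof eventually_elim
      case (elim z)
      then show ?case
        using g0[of z] by (simp add: ennreal_eq_0_iff mult_le_0_iff)
    qed
    then have "(\<integral>\<^sup>+z. ennreal (g z) \<partial>lborel) = 0"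
      by (subst nn_integral_0_iff_AE) auto
    with mass \<open>E > 0\<close> show False
      by simp
  qed
  have AEfst: "AE z in (lborel :: ((real^2) \<times> (real^2)) measure). fst z \<noteq> 0"
    and AEsnd: "AE z in (lborel :: ((real^2) \<times> (real^2)) measure). snd z \<noteq> 0"
  proof -
    have "AE x in (lborel :: (real^2) measure). AE y in (lborel :: (real^2) measure). x \<noteq> 0"
      using AE_lborel_singleton[of "0 :: real^2"] by eventually_elim auto
    moreover have "{z \<in> space ((lborel :: (real^2) measure) \<Otimes>\<^sub>M (lborel :: (real^2) measure)). fst z \<noteq> 0}
        \<in> sets (lborel \<Otimes>\<^sub>M lborel)"
      by measurable
    ultimately have "AE z in (lborel :: (real^2) measure) \<Otimes>\<^sub>M (lborel :: (real^2) measure). fst z \<noteq> 0"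
      using lborel_pair.AE_pair_measure[of "\<lambda>z. fst z \<noteq> 0"] by simp
    then show "AE z in (lborel :: ((real^2) \<times> (real^2)) measure). fst z \<noteq> 0"
      by (simp only: lborel_prod)
    have "AE x in (lborel :: (real^2) measure). AE y in (lborel :: (real^2) measure). y \<noteq> 0"
      by (intro AE_I2 AE_lborel_singleton)
    moreover have "{z \<in> space ((lborel :: (real^2) measure) \<Otimes>\<^sub>M (lborel :: (real^2) measure)). snd z \<noteq> 0}
        \<in> sets (lborel \<Otimes>\<^sub>M lborel)"
      by measurable
    ultimately have "AE z in (lborel :: (real^2) measure) \<Otimes>\<^sub>M (lborel :: (real^2) measure). snd z \<noteq> 0"
      using lborel_pair.AE_pair_measure[of "\<lambda>z. snd z \<noteq> 0"] by simp
    then show "AE z in (lborel :: ((real^2) \<times> (real^2)) measure). snd z \<noteq> 0"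
      by (simp only: lborel_prod)
  qed
  have nz: "M fst \<noteq> 0" "M snd \<noteq> 0"
    by (intro nonzero AEfst AEsnd; simp add: borel_prod[symmetric])+
  show ?thesis
  proof (cases "M fst = top \<or> M snd = top")
    case True
    then have "ennsqrt (M fst) * ennsqrt (M snd) = top"
      using nz by (auto simp: ennsqrt_def ennreal_mult_eq_top_iff ennsqrt_eq_0_iff[unfolded ennsqrt_def])
    then show ?thesis
      by (simp add: M_def)
  next
    case False
    then obtain m1 m2 where m: "M fst = ennreal m1" "M snd = ennreal m2" "0 \<le> m1" "0 \<le> m2"
      by (metis ennreal_cases)
    with nz have "m1 > 0" "m2 > 0"
      by (auto simp: less_le)
    then obtain R S where "R > 0" "S > 0" and RS: "R * S = \<rho>"
      and eqR: "m1 / R powr (2 * s) = sqrt (m1 * m2) / \<rho> powr s"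
      and eqS: "m2 / S powr (2 * s) = sqrt (m1 * m2) / \<rho> powr s"
      using balanced_radii[OF \<open>m1 > 0\<close> \<open>m2 > 0\<close> \<open>\<rho> > 0\<close> \<open>s > 0\<close>] by blast
    have KRS: "K * (pi * R\<^sup>2) * (pi * S\<^sup>2) = 1 / 2"
    proof -
      have "K * (pi * R\<^sup>2) * (pi * S\<^sup>2) = K * (pi * (R * S))\<^sup>2"
        by (simp add: power_mult_distrib power2_eq_square)
      also have "pi * (R * S) = 1 / sqrt (2 * K)"
        by (simp add: RS \<rho>_def)
      finally show ?thesis
        using \<open>K > 0\<close> by (simp add: power_divide)
    qed
    let ?B = "cball (0 :: real^2) R \<times> cball (0 :: real^2) S"
    have [measurable]: "?B \<in> sets borel"
      by (intro borel_closed closed_Times) auto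
    have [measurable]: "fst \<in> borel_measurable (borel :: ((real^2) \<times> (real^2)) measure)"
      "snd \<in> borel_measurable (borel :: ((real^2) \<times> (real^2)) measure)"
      by (simp_all add: borel_prod[symmetric])
    \<comment> \<open>Chebyshev's argument: on the box the uniform bound applies; off it one of the
      quotients \<open>norm (fst z) / R\<close>, \<open>norm (snd z) / S\<close> exceeds 1, and so
      does its power.\<close>
    have ptw: "ennreal (g z) \<le> ennreal (K * E) * indicator ?B z
        + ennreal (1 / R powr (2 * s)) * ennreal (norm (fst z) powr (2 * s) * g z)
        + ennreal (1 / S powr (2 * s)) * ennreal (norm (snd z) powr (2 * s) * g z)" for z
    proof -
      have tail: "ennreal (g z) \<le> ennreal (1 / T powr (2 * s)) * ennreal (r powr (2 * s) * g z)"
        if "r > T" "T > 0" for r T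
      proof -
        have "1 \<le> 1 / T powr (2 * s) * r powr (2 * s)"
          using that \<open>s > 0\<close> by (simp add: field_simps powr_mono2)
        then have "1 * g z \<le> (1 / T powr (2 * s) * r powr (2 * s)) * g z"
          using g0 by (intro mult_right_mono)
        then show ?thesis
          by (simp add: ennreal_mult'[symmetric] ennreal_leI mult.assoc)
      qed
      have summand: "x \<le> a + b + c" if "x \<le> a \<or> x \<le> b \<or> x \<le> c" for x a b c :: ennreal
        using that by (elim disjE) (simp_all add: add_increasing add_increasing2)
      have "z \<in> ?B \<or> norm (fst z) > R \<or> norm (snd z) > S"
        by (simp add: mem_Times_iff) linarith
      then consider "z \<in> ?B" | "norm (fst z) > R" | "norm (snd z) > S"
        by blast
      then show ?thesis
      proof cases
        case 1
        then have "ennreal (g z) \<le> ennreal (K * E) * indicator ?B z"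
          using bound[of z] by (simp add: ennreal_leI)
        then show ?thesis
          by (intro summand) simp
      next
        case 2
        show ?thesis
          by (intro summand disjI2 disjI1 tail 2 \<open>R > 0\<close>)
      next
        case 3
        show ?thesis
          by (intro summand disjI2 tail 3 \<open>S > 0\<close>)
      qed
    qed
    have emB: "emeasure lborel ?B = ennreal (pi * R\<^sup>2) * ennreal (pi * S\<^sup>2)"
      using \<open>R > 0\<close> \<open>S > 0\<close>
      by (simp add: lborel_prod[symmetric] lborel.emeasure_pair_measure_Times emeasure_cball_real2)
    have "ennreal E \<le> (\<integral>\<^sup>+z. ennreal (g z) \<partial>lborel)"
      by (rule mass)
    also have "\<dots> \<le> (\<integral>\<^sup>+z. ennreal (K * E) * indicator ?B z
        + ennreal (1 / R powr (2 * s)) * ennreal (norm (fst z) powr (2 * s) * g z)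
        + ennreal (1 / S powr (2 * s)) * ennreal (norm (snd z) powr (2 * s) * g z) \<partial>lborel)"
      by (intro nn_integral_mono ptw)
    also have "\<dots> = ennreal (K * E) * emeasure lborel ?B
        + ennreal (1 / R powr (2 * s)) * M fst + ennreal (1 / S powr (2 * s)) * M snd"
      unfolding M_def by (simp add: nn_integral_add nn_integral_cmult nn_integral_cmult_indicator)
    also have "\<dots> = ennreal (K * E * (pi * R\<^sup>2) * (pi * S\<^sup>2) + m1 / R powr (2 * s) + m2 / S powr (2 * s))"
      using \<open>K > 0\<close> \<open>E > 0\<close> \<open>m1 > 0\<close> \<open>m2 > 0\<close>
      by (simp add: m emB ennreal_mult[symmetric] ennreal_plus[symmetric] mult.assoc del: ennreal_plus)
    finally have "E \<le> K * E * (pi * R\<^sup>2) * (pi * S\<^sup>2) + m1 / R powr (2 * s) + m2 / S powr (2 * s)"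
      using \<open>K > 0\<close> \<open>E > 0\<close> \<open>m1 > 0\<close> \<open>m2 > 0\<close> by (subst (asm) ennreal_le_iff) auto
    also have "K * E * (pi * R\<^sup>2) * (pi * S\<^sup>2) = E / 2"
      using arg_cong[OF KRS, of "\<lambda>x. E * x"] by (simp add: mult_ac)
    \<comment> \<open>Half of \<open>E\<close> is absorbed on the left; the two remaining terms are
      equal by the choice of the radii.\<close>
    finally have "E / 4 \<le> sqrt (m1 * m2) / \<rho> powr s"
      unfolding eqR eqS by linarith
    then have "\<rho> powr s / 4 * E \<le> sqrt m1 * sqrt m2"
      using \<open>\<rho> > 0\<close> by (simp add: field_simps real_sqrt_mult)
    then have "ennreal (\<rho> powr s / 4 * E) \<le> ennsqrt (M fst) * ennsqrt (M snd)"
      using m by (simp add: ennsqrt_ennreal ennreal_mult[symmetric] ennreal_leI)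
    then show ?thesis
      by (simp add: M_def)
  qed
qed

text \<open>The chirps are unimodular and depend on \<open>x\<close> alone, so they join the signal
  without changing its norm. The frequency factors leave the integral on their own sides and
  contribute their constant norms, whose squares make up the denominator. Cauchy--Schwarz gives
  integrability of \<open>H\<close> and the last bound for every \<open>y\<close>.\<close>

lemma GQLCT_two_sided_ft:
  fixes A1 A2 :: "real^2^2" and y :: "real^2"
  assumes f: "f \<in> borel_measurable lebesgue" and \<phi>: "\<phi> \<in> borel_measurable lebesgue"
    and [measurable]: "f' \<in> borel_measurable borel" "\<phi>' \<in> borel_measurable borel"
    and AE: "AE x in lborel. f x = f' x" "AE x in lborel. \<phi> x = \<phi>' x"
    and int: "integrable lborel (\<lambda>x. (norm (f' x))\<^sup>2)" "integrable lborel (\<lambda>x. (norm (\<phi>' x))\<^sup>2)"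
    and b: "A1$1$2 \<noteq> 0" "A2$1$2 \<noteq> 0"
  defines "H \<equiv> \<lambda>x. lct_chirp qi A1 (x$1) * f' x * qcnj (\<phi>' (x - y)) * lct_chirp qj A2 (x$2)"
  shows "(norm (GQLCT A1 A2 \<phi> f \<omega> y))\<^sup>2
      = (norm (two_sided_ft qi qj (A1$1$2) (A2$1$2) H \<omega>))\<^sup>2 / ((2 * pi)\<^sup>2 * \<bar>A1$1$2 * A2$1$2\<bar>)"
    and "integrable lborel H"
    and "norm (H x) = norm (f' x) * norm (\<phi>' (x - y))"
    and "(\<integral>x. norm (H x) \<partial>lborel)\<^sup>2
      \<le> (\<integral>x. (norm (f' x))\<^sup>2 \<partial>lborel) * (\<integral>x. (norm (\<phi>' x))\<^sup>2 \<partial>lborel)"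
proof -
  note unit = norm_qcis[OF qi_qj_square(1)] norm_qcis[OF qi_qj_square(2)]
  have [measurable]: "H \<in> borel_measurable borel"
    unfolding H_def by measurable
  show nH: "norm (H x) = norm (f' x) * norm (\<phi>' (x - y))" for x
    by (simp add: H_def norm_mult norm_lct_chirp qi_qj_square)
  have int\<phi>: "integrable lborel (\<lambda>x. (norm (\<phi>' (x - y)))\<^sup>2)"
    and val\<phi>: "(\<integral>x. (norm (\<phi>' (x - y)))\<^sup>2 \<partial>lborel) = (\<integral>x. (norm (\<phi>' x))\<^sup>2 \<partial>lborel)"
    using lborel_integral_translate[of "\<lambda>x. (norm (\<phi>' x))\<^sup>2" y] int(2) by simp_all
  have nH_int: "integrable lborel (\<lambda>x. norm (f' x) * norm (\<phi>' (x - y)))"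
    by (intro integrable_inner_L2 int int\<phi>) auto
  then have "integrable lborel (\<lambda>x. norm (H x))"
    by (simp add: nH)
  then show H_int: "integrable lborel H"
    by (subst (asm) integrable_norm_iff) auto
  have "(\<integral>\<^sup>+x. ennreal (norm (f' x)) * ennreal (norm (\<phi>' (x - y))) \<partial>lborel)\<^sup>2
      \<le> (\<integral>\<^sup>+x. (ennreal (norm (f' x)))\<^sup>2 \<partial>lborel) * (\<integral>\<^sup>+x. (ennreal (norm (\<phi>' (x - y))))\<^sup>2 \<partial>lborel)"
    by (intro Cauchy_Schwarz_nn_integral) auto
  then have "ennreal ((\<integral>x. norm (H x) \<partial>lborel)\<^sup>2)
      \<le> ennreal ((\<integral>x. (norm (f' x))\<^sup>2 \<partial>lborel) * (\<integral>x. (norm (\<phi>' x))\<^sup>2 \<partial>lborel))"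
    using int int\<phi> nH_int val\<phi>
    by (simp add: nH ennreal_mult[symmetric] ennreal_power nn_integral_eq_integral)
  then show "(\<integral>x. norm (H x) \<partial>lborel)\<^sup>2
      \<le> (\<integral>x. (norm (f' x))\<^sup>2 \<partial>lborel) * (\<integral>x. (norm (\<phi>' x))\<^sup>2 \<partial>lborel)"
    by (subst (asm) ennreal_le_iff) auto
  let ?e = "\<lambda>x. qcis qi (- (x$1 * \<omega>$1 / A1$1$2)) * H x * qcis qj (- (x$2 * \<omega>$2 / A2$1$2))"
  have "integrable lborel ?e"
  proof (rule Bochner_Integration.integrable_bound[OF H_int])
    show "?e \<in> borel_measurable lborel"
      by measurable
  qed (simp add: norm_mult unit)
  moreover have "GQLCT A1 A2 \<phi> f \<omega> y
      = (\<integral>x. lct_factor qi A1 (\<omega>$1) * ?e x * lct_factor qj A2 (\<omega>$2) \<partial>lborel)"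
    unfolding GQLCT_borel_representative[OF f \<phi> assms(3,4) AE]
      lct_kernel_factorization(1)[OF qi_qj_square(1)] lct_kernel_factorization(2)[OF qi_qj_square(2)]
    by (simp add: H_def mult.assoc)
  ultimately have "GQLCT A1 A2 \<phi> f \<omega> y
      = lct_factor qi A1 (\<omega>$1) * two_sided_ft qi qj (A1$1$2) (A2$1$2) H \<omega> * lct_factor qj A2 (\<omega>$2)"
    by (simp add: two_sided_ft_def)
  then have "(norm (GQLCT A1 A2 \<phi> f \<omega> y))\<^sup>2
      = (norm (two_sided_ft qi qj (A1$1$2) (A2$1$2) H \<omega>))\<^sup>2
        * ((1 / sqrt (2 * pi * \<bar>A1$1$2\<bar>))\<^sup>2 * (1 / sqrt (2 * pi * \<bar>A2$1$2\<bar>))\<^sup>2)"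
    by (simp add: norm_mult norm_lct_factor qi_qj_square power_mult_distrib power_divide)
  also have "(1 / sqrt (2 * pi * \<bar>A1$1$2\<bar>))\<^sup>2 * (1 / sqrt (2 * pi * \<bar>A2$1$2\<bar>))\<^sup>2
      = 1 / ((2 * pi)\<^sup>2 * \<bar>A1$1$2 * A2$1$2\<bar>)"
    by (simp add: power_divide abs_mult power2_eq_square)
  finally show "(norm (GQLCT A1 A2 \<phi> f \<omega> y))\<^sup>2
      = (norm (two_sided_ft qi qj (A1$1$2) (A2$1$2) H \<omega>))\<^sup>2 / ((2 * pi)\<^sup>2 * \<bar>A1$1$2 * A2$1$2\<bar>)"
    by simp
qed

text \<open>Joint measurability in frequency and window position, as required by the integral over
  both.\<close>

lemma measurable_two_sided_ft_param:
  fixes H :: "'a::euclidean_space \<Rightarrow> real^2 \<Rightarrow> quat"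
  assumes [measurable]: "(\<lambda>(y, x). H y x) \<in> borel_measurable (borel \<Otimes>\<^sub>M borel)"
  shows "(\<lambda>z. two_sided_ft u v b c (H (snd z)) (fst z)) \<in> borel_measurable (borel \<Otimes>\<^sub>M borel)"
  unfolding two_sided_ft_def by measurable

text \<open>These are the hypotheses of \<open>moment_product_lower_bound\<close>. In the mass bound
  the factor \<open>(2 * pi)\<^sup>2 * \<bar>A1$1$2 * A2$1$2\<bar>\<close> from the Plancherel
  inequality cancels the denominator produced by the kernels, which leaves exactly
  \<open>E\<close>.\<close>

lemma GQLCT_square_properties:
  fixes A1 A2 :: "real^2^2"
  assumes f: "f \<in> L2H" and \<phi>: "\<phi> \<in> L2H" and b: "A1$1$2 * A2$1$2 \<noteq> 0"
  defines "E \<equiv> (L2H_norm f)\<^sup>2 * (L2H_norm \<phi>)\<^sup>2"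
  defines "g \<equiv> \<lambda>z. (norm (GQLCT A1 A2 \<phi> f (fst z) (snd z)))\<^sup>2"
  shows "g \<in> borel_measurable borel"
    and "g z \<le> 1 / ((2 * pi)\<^sup>2 * \<bar>A1$1$2 * A2$1$2\<bar>) * E"
    and "ennreal E \<le> (\<integral>\<^sup>+z. ennreal (g z) \<partial>lborel)"
proof -
  let ?D = "(2 * pi)\<^sup>2 * \<bar>A1$1$2 * A2$1$2\<bar>"
  have D: "?D > 0"
    using b by simp
  have b12: "A1$1$2 \<noteq> 0" "A2$1$2 \<noteq> 0"
    using b by auto
  have f_leb: "f \<in> borel_measurable lebesgue" and \<phi>_leb: "\<phi> \<in> borel_measurable lebesgue"
    and f_int: "integrable lebesgue (\<lambda>x. (norm (f x))\<^sup>2)"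
    and \<phi>_int: "integrable lebesgue (\<lambda>x. (norm (\<phi> x))\<^sup>2)"
    using f \<phi> by (auto simp: L2H_def)
  obtain f' \<phi>' where [measurable]: "f' \<in> borel_measurable borel" "\<phi>' \<in> borel_measurable borel"
    and AE: "AE x in lborel. f x = f' x" "AE x in lborel. \<phi> x = \<phi>' x"
    using lebesgue_ex_borel_AE_eq[OF f_leb] lebesgue_ex_borel_AE_eq[OF \<phi>_leb] by auto
  have transfer: "integrable lborel (\<lambda>x. (norm (h' x))\<^sup>2) \<and> (\<integral>x. (norm (h' x))\<^sup>2 \<partial>lborel) = (L2H_norm h)\<^sup>2"
    if h: "h \<in> borel_measurable lebesgue" "integrable lebesgue (\<lambda>x. (norm (h x))\<^sup>2)"
      and [measurable]: "h' \<in> borel_measurable borel" and AEh: "AE x in lborel. h x = h' x" for h h'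
  proof -
    have m': "(\<lambda>x. (norm (h' x))\<^sup>2) \<in> borel_measurable lborel"
      by measurable
    have ml: "(\<lambda>x. (norm (h' x))\<^sup>2) \<in> borel_measurable lebesgue"
      using m' by (rule measurable_completion)
    have AE': "AE x in lebesgue. (norm (h x))\<^sup>2 = (norm (h' x))\<^sup>2"
      unfolding AE_completion_iff using AEh by eventually_elim simp
    have "integrable lebesgue (\<lambda>x. (norm (h' x))\<^sup>2)"
      using integrable_cong_AE_imp[OF h(2) ml] AE' by (auto elim: eventually_mono)
    moreover have "(\<integral>x. (norm (h x))\<^sup>2 \<partial>lebesgue) = (\<integral>x. (norm (h' x))\<^sup>2 \<partial>lebesgue)"
      using h(2) by (intro integral_cong_AE ml AE') auto
    ultimately show ?thesis
      using m' by (simp add: integrable_completion integral_completion L2H_norm_def)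
  qed
  note tf = transfer[OF f_leb f_int _ AE(1)] and t\<phi> = transfer[OF \<phi>_leb \<phi>_int _ AE(2)]
  have int: "integrable lborel (\<lambda>x. (norm (f' x))\<^sup>2)" "integrable lborel (\<lambda>x. (norm (\<phi>' x))\<^sup>2)"
    and norms: "(L2H_norm f)\<^sup>2 = (\<integral>x. (norm (f' x))\<^sup>2 \<partial>lborel)" "(L2H_norm \<phi>)\<^sup>2 = (\<integral>x. (norm (\<phi>' x))\<^sup>2 \<partial>lborel)"
    using tf t\<phi> by simp_all
  define H where "H y = (\<lambda>x. lct_chirp qi A1 (x$1) * f' x * qcnj (\<phi>' (x - y)) * lct_chirp qj A2 (x$2))" for y
  note T = GQLCT_two_sided_ft[OF f_leb \<phi>_leb _ _ AE int b12, folded H_def]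
  have H_meas: "(\<lambda>(y, x). H y x) \<in> borel_measurable (borel \<Otimes>\<^sub>M borel)"
    unfolding H_def by measurable
  have [measurable]: "H y \<in> borel_measurable borel" for y
    unfolding H_def by measurable
  define q where "q y w = two_sided_ft qi qj (A1$1$2) (A2$1$2) (H y) w" for y w
  have g_eq: "g z = (norm (q (snd z) (fst z)))\<^sup>2 / ?D" for z
    by (simp add: g_def T(1) q_def)
  have q_meas: "(\<lambda>z. q (snd z) (fst z)) \<in> borel_measurable borel"
    using measurable_two_sided_ft_param[OF H_meas] by (simp add: q_def borel_prod)
  show g_meas [measurable]: "g \<in> borel_measurable borel"
    unfolding g_eq[abs_def] using q_meas by measurable
  show "g z \<le> 1 / ?D * E"
  proof -
    have "(norm (q (snd z) (fst z)))\<^sup>2 \<le> (\<integral>x. norm (H (snd z) x) \<partial>lborel)\<^sup>2"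
      unfolding q_def
      by (intro power_mono norm_two_sided_ft_le qi_qj_square b12 T(2)) auto
    also have "\<dots> \<le> E"
      using T(4)[of "snd z"] by (simp add: E_def norms H_def)
    finally show ?thesis
      using D by (simp add: g_eq divide_right_mono)
  qed
  have nnf: "(\<integral>\<^sup>+x. ennreal ((norm (f' x))\<^sup>2) \<partial>lborel) = ennreal ((L2H_norm f)\<^sup>2)"
    and nn\<phi>: "(\<integral>\<^sup>+x. ennreal ((norm (\<phi>' x))\<^sup>2) \<partial>lborel) = ennreal ((L2H_norm \<phi>)\<^sup>2)"
    using int norms by (simp_all add: nn_integral_eq_integral)
  have H_sq: "ennreal ((norm (H y x))\<^sup>2) = ennreal ((norm (f' x))\<^sup>2) * ennreal ((norm (\<phi>' (x - y)))\<^sup>2)" for x y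
    by (simp add: H_def T(3) power_mult_distrib ennreal_mult)
  \<comment> \<open>By Tonelli the integral over \<open>y\<close> comes first; for fixed
    \<open>x\<close> the map from \<open>y\<close> to \<open>x - y\<close> preserves Lebesgue
    measure, so the inner integral is the squared norm of the window whatever \<open>x\<close>
    is.\<close>
  have mass: "(\<integral>\<^sup>+y. (\<integral>\<^sup>+x. ennreal ((norm (H y x))\<^sup>2) \<partial>lborel) \<partial>lborel) = ennreal E"
  proof -
    have "(\<integral>\<^sup>+y. (\<integral>\<^sup>+x. ennreal ((norm (H y x))\<^sup>2) \<partial>lborel) \<partial>lborel)
        = (\<integral>\<^sup>+x. (\<integral>\<^sup>+y. ennreal ((norm (f' x))\<^sup>2) * ennreal ((norm (\<phi>' (x - y)))\<^sup>2) \<partial>lborel) \<partial>lborel)"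
      unfolding H_sq by (rule lborel_pair.Fubini') measurable
    also have "\<dots> = (\<integral>\<^sup>+x. ennreal ((norm (f' x))\<^sup>2) * ennreal ((L2H_norm \<phi>)\<^sup>2) \<partial>lborel)"
      by (simp add: nn_integral_cmult nn_integral_lborel_reflect[of "\<lambda>x. ennreal ((norm (\<phi>' x))\<^sup>2)"] nn\<phi>)
    also have "\<dots> = ennreal E"
      by (simp add: nn_integral_multc nnf E_def ennreal_mult)
    finally show ?thesis .
  qed
  \<comment> \<open>Finiteness is assumed because the Plancherel inequality requires a square
    integrable slice.\<close>
  have slice: "(\<integral>\<^sup>+x. ennreal ((norm (H y x))\<^sup>2) \<partial>lborel) \<le> (\<integral>\<^sup>+w. ennreal (g (w, y)) \<partial>lborel)"
    if "(\<integral>\<^sup>+x. ennreal ((norm (H y x))\<^sup>2) \<partial>lborel) < \<infinity>" for y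
  proof -
    have i: "integrable lborel (\<lambda>x. (norm (H y x))\<^sup>2)"
      using that by (intro integrableI_nonneg) auto
    have "(\<integral>\<^sup>+x. ennreal ((norm (H y x))\<^sup>2) \<partial>lborel) = ennreal (1 / ?D) * ennreal (?D * (\<integral>x. (norm (H y x))\<^sup>2 \<partial>lborel))"
      using D i b12 by (simp add: nn_integral_eq_integral flip: ennreal_mult')
    also have "\<dots> \<le> ennreal (1 / ?D) * (\<integral>\<^sup>+w. ennreal ((norm (q y w))\<^sup>2) \<partial>lborel)"
      unfolding q_def
      by (intro mult_left_mono two_sided_ft_L2_lower_bound qi_qj_square b12 T(2) i) auto
    also have "\<dots> = (\<integral>\<^sup>+w. ennreal (1 / ?D) * ennreal ((norm (q y w))\<^sup>2) \<partial>lborel)"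
      unfolding q_def using measurable_two_sided_ft[OF qi_qj_square b12 _ T(2)[of y]]
      by (subst nn_integral_cmult) auto
    also have "\<dots> = (\<integral>\<^sup>+w. ennreal (g (w, y)) \<partial>lborel)"
      using D by (simp add: g_eq flip: ennreal_mult')
    finally show ?thesis .
  qed
  have "ennreal E = (\<integral>\<^sup>+y. (\<integral>\<^sup>+x. ennreal ((norm (H y x))\<^sup>2) \<partial>lborel) \<partial>lborel)"
    by (rule mass[symmetric])
  also have "\<dots> \<le> (\<integral>\<^sup>+y. (\<integral>\<^sup>+w. ennreal (g (w, y)) \<partial>lborel) \<partial>lborel)"
  proof (rule nn_integral_mono_AE)
    \<comment> \<open>The integral of the slice norms over \<open>y\<close> is the finite number
      \<open>E\<close>, so almost every slice is square integrable.\<close>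
    have "AE y in lborel. (\<integral>\<^sup>+x. ennreal ((norm (H y x))\<^sup>2) \<partial>lborel) \<noteq> \<infinity>"
    proof (rule nn_integral_PInf_AE)
      show "(\<lambda>y. \<integral>\<^sup>+x. ennreal ((norm (H y x))\<^sup>2) \<partial>lborel) \<in> borel_measurable lborel"
        using H_meas by measurable
    qed (simp add: mass)
    then show "AE y in lborel. (\<integral>\<^sup>+x. ennreal ((norm (H y x))\<^sup>2) \<partial>lborel) \<le> (\<integral>\<^sup>+w. ennreal (g (w, y)) \<partial>lborel)"
      by eventually_elim (auto intro!: slice simp: less_top)
  qed
  also have "\<dots> = (\<integral>\<^sup>+z. ennreal (g z) \<partial>(lborel \<Otimes>\<^sub>M lborel))"
    using g_meas by (intro lborel_pair.nn_integral_snd) (simp add: lborel_prod)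
  also have "\<dots> = (\<integral>\<^sup>+z. ennreal (g z) \<partial>lborel)"
    by (simp only: lborel_prod)
  finally show "ennreal E \<le> (\<integral>\<^sup>+z. ennreal (g z) \<partial>lborel)" .
qed

theorem theorem3p1:
  fixes A1 A2 :: "real^2^2" and s :: real
  assumes "det A1 = 1" and "det A2 = 1"
    and "A1$1$2 * A2$1$2 \<noteq> 0"
    and "s > 0"
  shows "\<exists>C>0. \<forall>f\<in>L2H. \<forall>\<phi>\<in>L2H.
    ennsqrt (\<integral>\<^sup>+(\<omega>, y). ennreal (norm \<omega> powr (2 * s) * (norm (GQLCT A1 A2 \<phi> f \<omega> y))\<^sup>2)
        \<partial>(lebesgue :: ((real^2) \<times> (real^2)) measure)) *
    ennsqrt (\<integral>\<^sup>+(\<omega>, y). ennreal (norm y powr (2 * s) * (norm (GQLCT A1 A2 \<phi> f \<omega> y))\<^sup>2)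
        \<partial>(lebesgue :: ((real^2) \<times> (real^2)) measure))
    \<ge> ennreal (C * (L2H_norm f)\<^sup>2 * (L2H_norm \<phi>)\<^sup>2)"
proof -
  define K where "K = 1 / ((2 * pi)\<^sup>2 * \<bar>A1$1$2 * A2$1$2\<bar>)"
  have "K > 0"
    using assms(3) by (simp add: K_def)
  \<comment> \<open>Unfolding \<open>K\<close>, the base of the power equals
    \<open>sqrt (2 * \<bar>A1$1$2 * A2$1$2\<bar>)\<close>: the constant depends on \<open>s\<close>
    and on the product of the upper right entries, but not on \<open>f\<close> or
    \<open>\<phi>\<close>.\<close>
  define C where "C = (1 / (pi * sqrt (2 * K))) powr s / 4"
  have "C > 0"
    using \<open>K > 0\<close> by (simp add: C_def)
  moreover have "ennreal (C * (L2H_norm f)\<^sup>2 * (L2H_norm \<phi>)\<^sup>2) \<le>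
    ennsqrt (\<integral>\<^sup>+(\<omega>, y). ennreal (norm \<omega> powr (2 * s) * (norm (GQLCT A1 A2 \<phi> f \<omega> y))\<^sup>2)
        \<partial>(lebesgue :: ((real^2) \<times> (real^2)) measure)) *
    ennsqrt (\<integral>\<^sup>+(\<omega>, y). ennreal (norm y powr (2 * s) * (norm (GQLCT A1 A2 \<phi> f \<omega> y))\<^sup>2)
        \<partial>(lebesgue :: ((real^2) \<times> (real^2)) measure))"
    if f: "f \<in> L2H" and \<phi>: "\<phi> \<in> L2H" for f \<phi>
  proof -
    note G = GQLCT_square_properties[OF f \<phi> assms(3), folded K_def]
    \<comment> \<open>The moments are stated over the completed measure;
      \<open>nn_integral_completion\<close> identifies them with those over
      \<open>lborel\<close>.\<close>
    show ?thesis
      using moment_product_lower_bound[OF G(1) _ G(2) G(3) \<open>K > 0\<close> \<open>s > 0\<close>]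
      by (simp add: C_def nn_integral_completion case_prod_unfold mult.assoc)
  qed
  ultimately show ?thesis
    by blast
qed

end
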